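(* (Upper bound.) For every $0<\gamma<1$ there is a constant $C_\gamma$, depending only on $\gamma$, such that for every $\gamma$-sparse family $\mathcal S$ of intervals in $\mathbb R$ and every $A_2$ weight $w$ on $\mathbb R$, $$\|\mathcal A^*_{\mathcal S}\|_{L^2(w)\to L^2(w)}\le C_\gamma\,[w]_{A_2}^{2}.$$ (Sharpness.) The inequality is sharp in the following sense: there exist a sparse family $\mathcal S$ of intervals in $\mathbb R$ and a sequence of $A_2$ weights $w_\alpha$ (indexed by positive parameters $\alpha$ tending to $0$) such that $$[w_\alpha]_{A_2}\to\infty\quad\text{as }\alpha\to0,$$ and for every function $\phi:[0,\infty)\to[0,\infty)$ with $\phi(x)/x^{2}\to0$ as $x\to\infty$, $$\frac{\|\mathcal A^*_{\mathcal S}\|_{L^2(w_\alpha)\to L^2(w_\alpha)}}{\phi([w_\alpha]_{A_2})}\to\infty\quad\text{as }\alpha\to0,$$ where the quotient is read as $+\infty$ if its denominator is $0$.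
   Context: Intervals are bounded intervals of $\mathbb R$ of positive length, and $|\cdot|$ is Lebesgue measure. A weight is a positive measurable function $w$ on $\mathbb R$. It is an $A_2$ weight if $$[w]_{A_2}:=\sup_I\Big(\frac1{|I|}\int_I w\Big)\Big(\frac1{|I|}\int_I w^{-1}\Big)<\infty,$$ the supremum being over all intervals $I$. A family $\mathcal S$ of intervals is called $\gamma$-sparse ($0<\gamma<1$) if there exist pairwise disjoint measurable subsets $E_A\subset A$, $A\in\mathcal S$, with $|E_A|\ge\gamma|A|$. It is called sparse if it is $\gamma$-sparse for some $\gamma\in(0,1)$. For an interval $B$ set $\langle f\rangle_B:=\frac1{|B|}\int_B|f|$ and $M_Bf:=\sup\{\langle f\rangle_A: A\text{ an interval},\ A\supset B\}$. The strong-sparse operator associated with a sparse family $\mathcal S$ is $$\mathcal A^*_{\mathcal S}f(x):=\sum_{A\in\mathcal S}(M_Af)\,\mathbf 1_A(x).$$ Norms: $\|f\|_{L^2(w)}=\big(\int_{\mathbb R}|f|^2w\big)^{1/2}$, and for a (sublinear) operator $T$, $\|T\|_{L^2(w)\to L^2(w)}$ is the supremum of $\|Tf\|_{L^2(w)}/\|f\|_{L^2(w)}$ over $f\in L^2(w)$, $f\neq0$. *)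

theory Defs
  imports "HOL-Analysis.Analysis"
begin

(* All averages, norms and suprema live in ennreal, so that they are defined without
   integrability side conditions. *)

definition bdd_interval :: "real set \<Rightarrow> bool" where
  "bdd_interval I \<longleftrightarrow> is_interval I \<and> bounded I \<and> 0 < emeasure lebesgue I"

definition weight :: "(real \<Rightarrow> real) \<Rightarrow> bool" where
  "weight w \<longleftrightarrow> w \<in> borel_measurable lebesgue \<and> (\<forall>x. 0 < w x)"

definition A2_const :: "(real \<Rightarrow> real) \<Rightarrow> ennreal" where
  "A2_const w = (SUP I\<in>{I. bdd_interval I}.
      ((\<integral>\<^sup>+x\<in>I. ennreal (w x) \<partial>lebesgue) / emeasure lebesgue I)
    * ((\<integral>\<^sup>+x\<in>I. ennreal (inverse (w x)) \<partial>lebesgue) / emeasure lebesgue I))"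

definition A2_weight :: "(real \<Rightarrow> real) \<Rightarrow> bool" where
  "A2_weight w \<longleftrightarrow> weight w \<and> A2_const w < \<infinity>"

definition gamma_sparse :: "real \<Rightarrow> real set set \<Rightarrow> bool" where
  "gamma_sparse \<gamma> S \<longleftrightarrow>
     (\<forall>A\<in>S. bdd_interval A) \<and>
     (\<exists>E :: real set \<Rightarrow> real set.
        (\<forall>A\<in>S. E A \<in> sets lebesgue \<and> E A \<subseteq> A \<and>
               ennreal \<gamma> * emeasure lebesgue A \<le> emeasure lebesgue (E A)) \<and>
        disjoint_family_on E S)"

definition sparse_family :: "real set set \<Rightarrow> bool" where
  "sparse_family S \<longleftrightarrow> (\<exists>\<gamma>. 0 < \<gamma> \<and> \<gamma> < 1 \<and> gamma_sparse \<gamma> S)"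

definition interval_avg :: "(real \<Rightarrow> real) \<Rightarrow> real set \<Rightarrow> ennreal" where
  "interval_avg f B = (\<integral>\<^sup>+x\<in>B. ennreal \<bar>f x\<bar> \<partial>lebesgue) / emeasure lebesgue B"

definition max_avg :: "real set \<Rightarrow> (real \<Rightarrow> real) \<Rightarrow> ennreal" where
  "max_avg B f = (SUP A\<in>{A. bdd_interval A \<and> B \<subseteq> A}. interval_avg f A)"

(* An unordered sum of nonnegative extended reals, hence always convergent in ennreal. *)
definition strong_sparse_op :: "real set set \<Rightarrow> (real \<Rightarrow> real) \<Rightarrow> real \<Rightarrow> ennreal" where
  "strong_sparse_op S f x = (\<Sum>\<^sub>\<infinity>A\<in>S. max_avg A f * indicator A x)"

definition ennreal_sqrt :: "ennreal \<Rightarrow> ennreal" where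
  "ennreal_sqrt x = (if x = \<infinity> then \<infinity> else ennreal (sqrt (enn2real x)))"

(* The L^2(w) norm of a function that is given by its absolute value g. *)
definition L2_norm :: "(real \<Rightarrow> real) \<Rightarrow> (real \<Rightarrow> ennreal) \<Rightarrow> ennreal" where
  "L2_norm w g = ennreal_sqrt (\<integral>\<^sup>+x. (g x)\<^sup>2 * ennreal (w x) \<partial>lebesgue)"

definition L2_space :: "(real \<Rightarrow> real) \<Rightarrow> (real \<Rightarrow> real) set" where
  "L2_space w = {f. f \<in> borel_measurable lebesgue \<and> L2_norm w (\<lambda>x. ennreal \<bar>f x\<bar>) < \<infinity>}"

(* Elements of L^2(w) are nonzero when they do not vanish almost everywhere; the quotient
   below then has a denominator in (0, \<infinity>). *)
definition L2_op_norm ::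
    "(real \<Rightarrow> real) \<Rightarrow> ((real \<Rightarrow> real) \<Rightarrow> real \<Rightarrow> ennreal) \<Rightarrow> ennreal" where
  "L2_op_norm w T = (SUP f\<in>{f \<in> L2_space w. \<not> (AE x in lebesgue. f x = 0)}.
      L2_norm w (T f) / L2_norm w (\<lambda>x. ennreal \<bar>f x\<bar>))"

(* In ennreal, 0 / 0 = 0; this quotient takes the value \<infinity> whenever b = 0. *)
definition ext_quotient :: "ennreal \<Rightarrow> ennreal \<Rightarrow> ennreal" where
  "ext_quotient a b = (if b = 0 then \<infinity> else a / b)"

end

(* Let Mx_mu denote the uncentred maximal function over open intervals with respect to a
   measure mu. On the line it is bounded on L2(mu) with an absolute constant for every mu, since
   a finite family of intervals has a subfamily with the same union that covers no point more
   than twice. Put mu = w dx, nu = dx / w, K = [w]_{A2} and H = Mx_mu (Mx_nu (|f| w) / w). The A2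
   condition bounds the average of |f| over an interval by K H at each of its points. So
   M_A f <= K inf_A H: the maximal averages cost one factor K, and sparse domination tested
   against a function g costs the second one, via

     (inf_A H) * int_A g w <= (K / gamma) * int_{E_A} Mx_nu (H w) * Mx_mu g dx.

   For the sharpness, the weight |x|^(1 - alpha) is of size 1/alpha in A2, and
   f = |x|^(alpha - 1) on (-1, 0) has large averages over (-r, 2 r) for every r <= 1. Hence M_A f is
   of size r^(alpha - 1) / alpha for all intervals A = (r, r + r / 2^k), so that A* f has a
   logarithmic singularity to the right of each r = 4^(-j). Adding to the weight an integrable
   spike alpha r^(2 - 2 alpha) |x - r|^(alpha - 1) near each such r keeps the A2 constant of order
   1/alpha, and makes these singularities contribute ||A* f|| >= c alpha^(-2) ||f||. The A2
   constants tend to infinity by the upper bound itself. *)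
theory Submission
  imports Defs
begin

section \<open>The maximal function of a measure on the line\<close>

text \<open>The averages M_A f see f far outside A, so the usual arguments for sparse operators,
  which localise f to A, do not apply. Replacing M_A f by K inf_A H makes the terms local again, but
  in H instead of f. The spikes are forced by the count of powers. The squared norm of f is 1/alpha.
  Against |x|^(1 - alpha) alone a logarithm is square integrable, so the overlap of the intervals at
  r = 4^(-j) adds only a constant factor: each r contributes about r^alpha / alpha^2, all r together
  alpha^(-3), and the quotient of the norms is only of order 1/alpha. The density alpha t^(alpha -
  1), t = |x - r|, instead spreads its mass almost evenly over about 1/alpha dyadic scales, and at
  relative scale 2^(-k) about k intervals overlap. With k typically of size 1/alpha the contribution
  of each r rises to r^alpha / alpha^4, the sum to alpha^(-5) and the quotient to
  alpha^(-2).\<close>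

definition max_fun :: "real measure \<Rightarrow> (real \<Rightarrow> ennreal) \<Rightarrow> real \<Rightarrow> ennreal" where
  "max_fun M g x = (SUP (a, b)\<in>{(a, b). a < x \<and> x < b}.
     (\<integral>\<^sup>+y\<in>{a<..<b}. g y \<partial>M) / emeasure M {a<..<b})"

lemma max_fun_upper:
  "a < x \<Longrightarrow> x < b \<Longrightarrow> (\<integral>\<^sup>+y\<in>{a<..<b}. g y \<partial>M) / emeasure M {a<..<b} \<le> max_fun M g x"
  unfolding max_fun_def by (rule SUP_upper2[of "(a,b)"]) auto

lemma max_fun_less_iff:
  "t < max_fun M g x \<longleftrightarrow> (\<exists>a b. a < x \<and> x < b \<and> t < (\<integral>\<^sup>+y\<in>{a<..<b}. g y \<partial>M) / emeasure M {a<..<b})"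
  unfolding max_fun_def by (auto simp: less_SUP_iff)

lemma max_fun_superlevel:
  "{x. t < max_fun M g x} =
    (\<Union>(a, b)\<in>{(a, b). t < (\<integral>\<^sup>+y\<in>{a<..<b}. g y \<partial>M) / emeasure M {a<..<b}}. {a<..<b})"
  unfolding set_eq_iff by (simp add: max_fun_less_iff) blast

text \<open>The reason for open intervals in \<open>max_fun\<close>: open superlevel sets give Borel
  measurability, and their representation as unions of open intervals is what Lindelof's theorem
  acts on below.\<close>

lemma open_max_fun_superlevel: "open {x. t < max_fun M g x}"
  unfolding max_fun_superlevel by (intro open_UN) auto

lemma borel_measurable_max_fun [measurable]: "max_fun M g \<in> borel_measurable borel"
  by (rule borel_measurableI_greater)
     (use open_max_fun_superlevel[of _ M g] in \<open>auto intro: borel_open\<close>)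

text \<open>A subfamily of least cardinality with the same union works. If three of its intervals
  shared a point x, then among those through x the one reaching furthest left and the one reaching
  furthest right would cover any third, which could be dropped.\<close>

lemma finite_intervals_subcover:
  fixes F :: "(real \<times> real) set"
  assumes "finite F"
  shows "\<exists>G\<subseteq>F. (\<Union>(a, b)\<in>G. {a<..<b}) = (\<Union>(a, b)\<in>F. {a<..<b}) \<and>
           (\<forall>x. card {p \<in> G. fst p < x \<and> x < snd p} \<le> 2)"
proof -
  let ?U = "\<lambda>G::(real \<times> real) set. \<Union>(a, b)\<in>G. {a<..<b}"
  define P where "P = (\<lambda>G. G \<subseteq> F \<and> ?U G = ?U F)"
  have "P F" by (simp add: P_def)
  then obtain G where G: "P G" and minG: "\<And>H. P H \<Longrightarrow> card G \<le> card H"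
    using ex_has_least_nat[of P F card, OF \<open>P F\<close>] by auto
  have finG: "finite G" using G assms by (auto simp: P_def intro: finite_subset)
  have "card {p \<in> G. fst p < x \<and> x < snd p} \<le> 2" for x
  proof (rule ccontr)
    define T where "T = {p \<in> G. fst p < x \<and> x < snd p}"
    assume "\<not> card {p \<in> G. fst p < x \<and> x < snd p} \<le> 2"
    then have card: "card T > 2" by (simp add: T_def)
    have finT: "finite T" "T \<noteq> {}" using finG card by (simp add: T_def, force)
    obtain p where p: "p \<in> T" "\<And>r. r \<in> T \<Longrightarrow> fst p \<le> fst r"
      using ex_is_arg_min_if_finite[OF finT, of fst] unfolding is_arg_min_def by (metis not_less)
    obtain q where q: "q \<in> T" "\<And>r. r \<in> T \<Longrightarrow> snd r \<le> snd q"
      using ex_is_arg_min_if_finite[OF finT, of "\<lambda>r. - snd r"] unfolding is_arg_min_def by (metis neg_less_iff_less not_less)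
    have "\<not> T \<subseteq> {p, q}"
    proof
      assume "T \<subseteq> {p, q}"
      then have "card T \<le> card {p, q}" by (intro card_mono) auto
      also have "\<dots> \<le> 2" by (simp add: card_insert_if)
      finally show False using card by simp
    qed
    then obtain r where r: "r \<in> T" "r \<noteq> p" "r \<noteq> q" by auto
    have pq: "p \<in> G - {r}" "q \<in> G - {r}" using p q r unfolding T_def by auto
    have "{fst r<..<snd r} \<subseteq> {fst p<..<snd p} \<union> {fst q<..<snd q}"
    proof
      fix y assume y: "y \<in> {fst r<..<snd r}"
      show "y \<in> {fst p<..<snd p} \<union> {fst q<..<snd q}"
        using p(2)[OF r(1)] q(2)[OF r(1)] y p(1) q(1) unfolding T_def by (cases "y \<le> x") auto
    qed
    also have "\<dots> \<subseteq> ?U (G - {r})" using pq by (force simp: case_prod_beta)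
    finally have sub: "{fst r<..<snd r} \<subseteq> ?U (G - {r})" .
    have "r \<in> G" using r unfolding T_def by simp
    have "?U G \<subseteq> ?U (G - {r})"
    proof
      fix y assume "y \<in> ?U G"
      then obtain s where s: "s \<in> G" "y \<in> {fst s<..<snd s}" by (auto simp: case_prod_beta)
      show "y \<in> ?U (G - {r})"
      proof (cases "s = r")
        case True
        then show ?thesis using s sub by blast
      next
        case False
        then have "s \<in> G - {r}" using s by simp
        then show ?thesis using s(2) by (force simp: case_prod_beta)
      qed
    qed
    then have "?U (G - {r}) = ?U G" by auto
    then have "P (G - {r})" using G unfolding P_def by auto
    then have "card G \<le> card (G - {r})" by (rule minG)
    then show False using \<open>r \<in> G\<close> finG
      by (metis card_Diff1_less not_le)
  qed
  then show ?thesis using G unfolding P_def by blast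
qed

text \<open>Summing the hypotheses over the thinned family costs only its overlap 2. The bound does
  not depend on the size of F, which is what survives the passage to infinite unions.\<close>

lemma emeasure_finite_intervals_le:
  fixes F :: "(real \<times> real) set" and g :: "real \<Rightarrow> ennreal"
  assumes sets: "sets borel \<subseteq> sets M" and g [measurable]: "g \<in> borel_measurable M"
    and F: "finite F" and sub: "\<And>a b. (a, b) \<in> F \<Longrightarrow> {a<..<b} \<subseteq> U" and U: "U \<in> sets M"
    and le: "\<And>a b. (a, b) \<in> F \<Longrightarrow> t * emeasure M {a<..<b} \<le> (\<integral>\<^sup>+y\<in>{a<..<b}. g y \<partial>M)"
  shows "t * emeasure M (\<Union>(a, b)\<in>F. {a<..<b}) \<le> 2 * (\<integral>\<^sup>+y\<in>U. g y \<partial>M)"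
proof -
  have [measurable]: "{a<..<b} \<in> sets M" for a b :: real
    using sets borel_open[OF open_greaterThanLessThan] by blast
  note U[measurable]
  obtain G where G: "G \<subseteq> F" "(\<Union>(a, b)\<in>G. {a<..<b}) = (\<Union>(a, b)\<in>F. {a<..<b})"
    and card: "\<And>x. card {p \<in> G. fst p < x \<and> x < snd p} \<le> 2"
    using finite_intervals_subcover[OF F] by blast
  have finG: "finite G" using G(1) F finite_subset by blast
  let ?I = "\<lambda>p::real \<times> real. {fst p<..<snd p}"
  have "t * emeasure M (\<Union>(a, b)\<in>F. {a<..<b}) = t * emeasure M (\<Union>p\<in>G. ?I p)"
    unfolding G(2)[symmetric] by (simp add: case_prod_beta)
  also have "\<dots> \<le> t * (\<Sum>p\<in>G. emeasure M (?I p))"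
    by (intro mult_left_mono emeasure_subadditive_finite finG) auto
  also have "\<dots> = (\<Sum>p\<in>G. t * emeasure M (?I p))" by (simp add: sum_distrib_left)
  also have "\<dots> \<le> (\<Sum>p\<in>G. \<integral>\<^sup>+y\<in>?I p. g y \<partial>M)"
    using G(1) by (intro sum_mono le) auto
  also have "\<dots> = (\<integral>\<^sup>+y. (\<Sum>p\<in>G. g y * indicator (?I p) y) \<partial>M)"
    by (intro nn_integral_sum[symmetric]) auto
  also have "\<dots> \<le> (\<integral>\<^sup>+y. 2 * (g y * indicator U y) \<partial>M)"
  proof (intro nn_integral_mono)
    fix y
    have "(\<Sum>p\<in>G. g y * indicator (?I p) y) = g y * (\<Sum>p\<in>G. indicator (?I p) y)"
      by (simp add: sum_distrib_left)
    also have "(\<Sum>p\<in>G. indicator (?I p) y :: ennreal) = of_nat (card {p \<in> G. fst p < y \<and> y < snd p})"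
    proof -
      have "(\<Sum>p\<in>G. indicator (?I p) y :: ennreal) = (\<Sum>p\<in>G. if fst p < y \<and> y < snd p then 1 else 0)"
        by (intro sum.cong) (auto simp: indicator_def)
      also have "\<dots> = of_nat (card {p \<in> G. fst p < y \<and> y < snd p})"
        using finG by (simp flip: sum.inter_filter)
      finally show ?thesis .
    qed
    also have "g y * of_nat (card {p \<in> G. fst p < y \<and> y < snd p}) \<le> 2 * (g y * indicator U y)"
    proof (cases "y \<in> U")
      case True
      have "of_nat (card {p \<in> G. fst p < y \<and> y < snd p}) \<le> (of_nat 2 :: ennreal)"
        using card[of y] by (simp only: of_nat_le_iff)
      then have "g y * of_nat (card {p \<in> G. fst p < y \<and> y < snd p}) \<le> g y * 2"
        by (intro mult_left_mono) auto
      then show ?thesis using True by (simp add: mult.commute)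
    next
      case False
      then have "{p \<in> G. fst p < y \<and> y < snd p} = {}"
        using sub G(1) by (fastforce simp: subset_iff)
      then show ?thesis by (metis card.empty mult_zero_right of_nat_0 zero_le)
    qed
    finally show "(\<Sum>p\<in>G. g y * indicator (?I p) y) \<le> 2 * (g y * indicator U y)" .
  qed
  also have "\<dots> = 2 * (\<integral>\<^sup>+y\<in>U. g y \<partial>M)" by (intro nn_integral_cmult) auto
  finally show ?thesis .
qed

lemma space_eq_UNIV_if_borel:
  assumes "sets borel \<subseteq> sets (M :: real measure)"
  shows "space M = UNIV"
proof -
  have "UNIV \<in> sets M" using assms by (rule subsetD) simp
  then show ?thesis using sets.sets_into_space by blast
qed

text \<open>The superlevel set is a union of intervals with average above t. Lindelof's theorem
  makes the union countable, and continuity from below reduces it to finite unions, where the bound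
  is uniform.\<close>

lemma max_fun_weak_type:
  fixes g :: "real \<Rightarrow> ennreal"
  assumes sets: "sets borel \<subseteq> sets M" and g [measurable]: "g \<in> borel_measurable M"
  shows "t * emeasure M {x. t < max_fun M g x} \<le> 2 * (\<integral>\<^sup>+y. g y \<partial>M)"
proof -
  let ?J = "{(a, b). t < (\<integral>\<^sup>+y\<in>{a<..<b}. g y \<partial>M) / emeasure M {a<..<b}}"
  let ?I = "\<lambda>p::real \<times> real. {fst p<..<snd p}"
  have le: "t * emeasure M {a<..<b} \<le> (\<integral>\<^sup>+y\<in>{a<..<b}. g y \<partial>M)" if "(a, b) \<in> ?J" for a b
  proof -
    let ?A = "\<integral>\<^sup>+y\<in>{a<..<b}. g y \<partial>M" and ?m = "emeasure M {a<..<b}"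
    have lt: "t < ?A / ?m" using that by simp
    show ?thesis
    \<comment> \<open>A quotient by \<infinity> is 0 in \<open>ennreal\<close>, so an interval of
      infinite measure cannot belong to \<open>?J\<close>; for measure 0 the left side of the claim
      vanishes.\<close>
    proof (cases "?m = \<infinity>")
      case True
      then show ?thesis using lt by (simp add: ennreal_divide_top)
    next
      case False
      show ?thesis
      proof (cases "?m = 0")
        case False
        have "t * ?m \<le> ?A / ?m * ?m" using lt by (intro mult_right_mono) auto
        also have "\<dots> = ?A" using \<open>?m \<noteq> \<infinity>\<close> False
          by (metis ennreal_divide_times ennreal_mult_divide_eq infinity_ennreal_def mult.commute mult.right_neutral)
        finally show ?thesis .
      qed simp
    qed
  qed
  define \<C> where "\<C> = ?I ` ?J"
  have op: "\<And>S. S \<in> \<C> \<Longrightarrow> open S" unfolding \<C>_def by auto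
  obtain \<D> where D: "\<D> \<subseteq> \<C>" "countable \<D>" "\<Union>\<D> = \<Union>\<C>"
    by (rule Lindelof[of \<C>, OF op])
  obtain J where J: "J \<subseteq> ?J" "countable J" "\<D> = ?I ` J"
    using D(1,2) countable_subset_image[of \<D> ?I ?J] unfolding \<C>_def by blast
  have U: "{x. t < max_fun M g x} = (\<Union>p\<in>J. ?I p)"
    unfolding max_fun_superlevel using D(3) unfolding \<C>_def J(3) by (simp add: case_prod_beta)
  show ?thesis
  proof (cases "J = {}")
    case True
    then show ?thesis unfolding U by simp
  next
    case False
    then obtain e :: "nat \<Rightarrow> real \<times> real" where e: "range e = J"
      using J(2) by (metis uncountable_def)
    have UN: "(\<Union>p\<in>J. ?I p) = (\<Union>n. \<Union>p\<in>e ` {..n}. ?I p)"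
      unfolding e[symmetric] by auto
    have meas: "(\<Union>p\<in>e ` {..n}. ?I p) \<in> sets M" for n
      using sets borel_open[OF open_greaterThanLessThan] by (intro sets.finite_UN) blast+
    have inc: "incseq (\<lambda>n. \<Union>p\<in>e ` {..n}. ?I p)"
      unfolding incseq_def by (intro allI impI UN_mono image_mono) auto
    have "t * emeasure M (\<Union>p\<in>J. ?I p) = t * (SUP n. emeasure M (\<Union>p\<in>e ` {..n}. ?I p))"
      unfolding UN using meas inc by (subst SUP_emeasure_incseq) auto
    also have "\<dots> = (SUP n. t * emeasure M (\<Union>p\<in>e ` {..n}. ?I p))"
      by (simp add: SUP_mult_left_ennreal)
    also have "\<dots> \<le> 2 * (\<integral>\<^sup>+y. g y \<partial>M)"
    proof (rule SUP_least)
      fix n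
      have "space M = UNIV"
        by (rule space_eq_UNIV_if_borel[OF sets])
      moreover have "UNIV \<in> sets M" using sets by (rule subsetD) simp
      ultimately have "t * emeasure M (\<Union>(a,b)\<in>e ` {..n}. {a<..<b}) \<le> 2 * (\<integral>\<^sup>+y\<in>space M. g y \<partial>M)"
        using e J(1) by (intro emeasure_finite_intervals_le[OF sets g]) (auto intro!: le)
      also have "(\<integral>\<^sup>+y\<in>space M. g y \<partial>M) = (\<integral>\<^sup>+y. g y \<partial>M)"
        by (intro nn_integral_cong) auto
      finally show "t * emeasure M (\<Union>p\<in>e ` {..n}. ?I p) \<le> 2 * (\<integral>\<^sup>+y. g y \<partial>M)"
        by (simp add: case_prod_beta)
    qed
    finally show ?thesis unfolding U .
  qed
qed

section \<open>From weak type to L2 bounds: layer cake and truncation\<close>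

lemma ennreal_square_layer_cake:
  "(c::ennreal)\<^sup>2 = (\<integral>\<^sup>+t. ennreal (2 * t) * indicator {t. 0 \<le> t \<and> ennreal t < c} t \<partial>lborel)"
proof -
  have *: "(\<integral>\<^sup>+t. ennreal (2 * t) * indicator {t. 0 \<le> t \<and> ennreal t < ennreal r} t \<partial>lborel) = (ennreal r)\<^sup>2"
    if "0 \<le> r" for r
  proof -
    have "AE t in lborel. t \<noteq> r" by (rule AE_lborel_singleton)
    then have "(\<integral>\<^sup>+t. ennreal (2 * t) * indicator {t. 0 \<le> t \<and> ennreal t < ennreal r} t \<partial>lborel)
        = (\<integral>\<^sup>+t. ennreal (2 * t) * indicator {0..r} t \<partial>lborel)"
      by (intro nn_integral_cong_AE) (auto simp: indicator_def ennreal_less_iff)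
    also have "\<dots> = ennreal (r\<^sup>2 - 0\<^sup>2)"
      using that by (intro nn_integral_FTC_Icc) (auto intro!: derivative_eq_intros)
    finally show ?thesis using that by (simp add: ennreal_power)
  qed
  show ?thesis
  proof (cases c)
    case (real r)
    then show ?thesis using *[of r] by simp
  next
    case top
    have "of_nat n \<le> (\<integral>\<^sup>+t. ennreal (2 * t) * indicator {t. 0 \<le> t \<and> ennreal t < c} t \<partial>lborel)" for n :: nat
    proof -
      have "of_nat n \<le> (ennreal (real n))\<^sup>2"
        by (simp add: ennreal_of_nat_eq_real_of_nat ennreal_power ennreal_leI power2_nat_le_imp_le flip: of_nat_power)
      also have "\<dots> = (\<integral>\<^sup>+t. ennreal (2 * t) * indicator {t. 0 \<le> t \<and> ennreal t < ennreal (real n)} t \<partial>lborel)"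
        by (rule *[symmetric]) simp
      also have "\<dots> \<le> (\<integral>\<^sup>+t. ennreal (2 * t) * indicator {t. 0 \<le> t \<and> ennreal t < c} t \<partial>lborel)"
        by (intro nn_integral_mono mult_left_mono) (auto simp: top indicator_def ennreal_less_top)
      finally show ?thesis .
    qed
    then have "(\<integral>\<^sup>+t. ennreal (2 * t) * indicator {t. 0 \<le> t \<and> ennreal t < c} t \<partial>lborel) = top"
      by (metis ennreal_Ex_less_of_nat infinity_ennreal_def leD top.not_eq_extremum)
    then show ?thesis by (simp add: top power2_eq_square)
  qed
qed

lemma emeasure_ennreal_half_less:
  "emeasure lborel {t. 0 \<le> t \<and> ennreal (t / 2) < c} = 2 * (c::ennreal)"
proof (cases c)
  case (real r)
  have "{t. 0 \<le> t \<and> ennreal (t / 2) < c} = {0..<2 * r}"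
    using real by (auto simp: ennreal_less_iff)
  then show ?thesis using real by (simp add: ennreal_mult)
next
  case top
  have "{t. 0 \<le> t \<and> ennreal (t / 2) < c} = {0..}"
    using top by (auto simp: ennreal_less_top)
  moreover have "emeasure lborel {0::real..} = \<infinity>"
  proof -
    have "of_nat n \<le> emeasure lborel {0::real..}" for n :: nat
    proof -
      have "of_nat n = emeasure lborel {0..real n}" by (simp add: ennreal_of_nat_eq_real_of_nat)
      also have "\<dots> \<le> emeasure lborel {0::real..}" by (intro emeasure_mono) auto
      finally show ?thesis .
    qed
    then show ?thesis
      by (metis ennreal_Ex_less_of_nat infinity_ennreal_def leD top.not_eq_extremum)
  qed
  ultimately show ?thesis using top by (simp add: ennreal_mult_top)
qed

text \<open>The part of g below height s raises no average by more than s. Hence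
  \<open>max_fun M g\<close> can exceed 2 s only where the maximal function of the part above s
  exceeds s, as in Marcinkiewicz interpolation.\<close>

lemma max_fun_truncate:
  fixes g :: "real \<Rightarrow> ennreal"
  assumes sets: "sets borel \<subseteq> sets M" and g [measurable]: "g \<in> borel_measurable M"
  shows "max_fun M g x \<le> max_fun M (\<lambda>y. g y * indicator {y. s < g y} y) x + s"
  unfolding max_fun_def[of M g]
proof (rule SUP_least, clarify)
  fix a b assume ab: "a < x" "x < b"
  have [measurable]: "{a<..<b} \<in> sets M"
    using sets borel_open[OF open_greaterThanLessThan] by blast
  have sp: "space M = UNIV"
    by (rule space_eq_UNIV_if_borel[OF sets])
  have [measurable]: "{y. s < g y} \<in> sets M"
    using measurable_sets[OF g, of "{s<..}"] by (simp add: sp vimage_def)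
  let ?g = "\<lambda>y. g y * indicator {y. s < g y} y"
  let ?m = "emeasure M {a<..<b}"
  have "(\<integral>\<^sup>+y\<in>{a<..<b}. g y \<partial>M) \<le> (\<integral>\<^sup>+y. ?g y * indicator {a<..<b} y + s * indicator {a<..<b} y \<partial>M)"
    by (intro nn_integral_mono) (auto simp: indicator_def not_less)
  also have "\<dots> = (\<integral>\<^sup>+y\<in>{a<..<b}. ?g y \<partial>M) + s * ?m"
    by (subst nn_integral_add) (auto simp: nn_integral_cmult_indicator)
  finally have "(\<integral>\<^sup>+y\<in>{a<..<b}. g y \<partial>M) / ?m \<le> ((\<integral>\<^sup>+y\<in>{a<..<b}. ?g y \<partial>M) + s * ?m) / ?m"
    by (rule divide_right_mono_ennreal)
  also have "\<dots> = (\<integral>\<^sup>+y\<in>{a<..<b}. ?g y \<partial>M) / ?m + s * ?m / ?m"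
    by (simp add: add_divide_distrib_ennreal)
  also have "\<dots> \<le> max_fun M ?g x + s"
  proof (intro add_mono max_fun_upper ab)
    show "s * ?m / ?m \<le> s"
    proof (cases "?m = 0 \<or> ?m = \<infinity>")
      case True
      then show ?thesis by (auto simp: ennreal_divide_top)
    next
      case False
      then show ?thesis by (simp add: ennreal_mult_divide_eq)
    qed
  qed
  finally show "(\<integral>\<^sup>+y\<in>{a<..<b}. g y \<partial>M) / ?m \<le> max_fun M ?g x + s" .
qed

text \<open>At level t the weak type bound is applied to the part of g above t/2. Writing 2 t = 4
  (t/2) and using the weak type constant 2 gives the factor 8; the levels t with t/2 < g x have
  total length 2 g x, which gives 16. Sigma-finiteness permits the exchange of integrals.\<close>

lemma max_fun_L2_bound:
  fixes g :: "real \<Rightarrow> ennreal"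
  assumes sets: "sets borel \<subseteq> sets M" and g [measurable]: "g \<in> borel_measurable M"
    and M: "sigma_finite_measure M"
  shows "(\<integral>\<^sup>+x. (max_fun M g x)\<^sup>2 \<partial>M) \<le> 16 * (\<integral>\<^sup>+x. (g x)\<^sup>2 \<partial>M)"
proof -
  have sp: "space M = UNIV"
    by (rule space_eq_UNIV_if_borel[OF sets])
  have mx: "max_fun M h \<in> borel_measurable M" for h
    using measurable_mono[of borel borel borel M] sets sp borel_measurable_max_fun[of M h] by auto
  note mx[of g, measurable]
  interpret M: sigma_finite_measure M by fact
  interpret pair_sigma_finite lborel M ..
  have weak: "ennreal (2 * t) * emeasure M {x. ennreal t < max_fun M g x}
      \<le> 8 * (\<integral>\<^sup>+x. g x * indicator {t. 0 \<le> t \<and> ennreal (t / 2) < g x} t \<partial>M)" if t: "0 \<le> t" for t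
  proof -
    let ?s = "ennreal (t / 2)"
    let ?g = "\<lambda>y. g y * indicator {y. ?s < g y} y"
    have [measurable]: "{y. ?s < g y} \<in> sets M"
      using measurable_sets[OF g, of "{?s<..}"] by (simp add: sp vimage_def)
    have tt: "ennreal t = ?s + ?s" using t by (simp flip: ennreal_plus)
    have "{x. ennreal t < max_fun M g x} \<subseteq> {x. ?s < max_fun M ?g x}"
    proof clarify
      fix x assume "ennreal t < max_fun M g x"
      also have "\<dots> \<le> max_fun M ?g x + ?s" by (rule max_fun_truncate[OF sets g])
      finally show "?s < max_fun M ?g x"
        unfolding tt by (metis add_right_mono not_less)
    qed
    moreover have "{x. ?s < max_fun M ?g x} \<in> sets M"
      using sets open_max_fun_superlevel borel_open by blast
    ultimately have "emeasure M {x. ennreal t < max_fun M g x} \<le> emeasure M {x. ?s < max_fun M ?g x}"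
      by (rule emeasure_mono)
    then have "ennreal (2 * t) * emeasure M {x. ennreal t < max_fun M g x}
        \<le> ennreal (2 * t) * emeasure M {x. ?s < max_fun M ?g x}"
      by (rule mult_left_mono) simp
    also have "\<dots> = 4 * (?s * emeasure M {x. ?s < max_fun M ?g x})"
      using t by (simp flip: mult.assoc ennreal_mult' ennreal_numeral)
    also have "\<dots> \<le> 4 * (2 * (\<integral>\<^sup>+y. ?g y \<partial>M))"
      by (intro mult_left_mono max_fun_weak_type sets) auto
    also have "\<dots> = 8 * (\<integral>\<^sup>+x. g x * indicator {t. 0 \<le> t \<and> ennreal (t / 2) < g x} t \<partial>M)"
      using t by (simp add: indicator_def flip: mult.assoc)
    finally show ?thesis .
  qed
  have "(\<integral>\<^sup>+x. (max_fun M g x)\<^sup>2 \<partial>M) =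
      (\<integral>\<^sup>+x. \<integral>\<^sup>+t. ennreal (2 * t) * indicator {t. 0 \<le> t \<and> ennreal t < max_fun M g x} t \<partial>lborel \<partial>M)"
    by (simp add: ennreal_square_layer_cake)
  also have "\<dots> = (\<integral>\<^sup>+t. \<integral>\<^sup>+x. ennreal (2 * t) * indicator {t. 0 \<le> t \<and> ennreal t < max_fun M g x} t \<partial>M \<partial>lborel)"
    by (rule Fubini') measurable
  also have "\<dots> \<le> (\<integral>\<^sup>+t. 8 * (\<integral>\<^sup>+x. g x * indicator {t. 0 \<le> t \<and> ennreal (t / 2) < g x} t \<partial>M) \<partial>lborel)"
  proof (intro nn_integral_mono)
    fix t :: real
    show "(\<integral>\<^sup>+x. ennreal (2 * t) * indicator {t. 0 \<le> t \<and> ennreal t < max_fun M g x} t \<partial>M)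
      \<le> 8 * (\<integral>\<^sup>+x. g x * indicator {t. 0 \<le> t \<and> ennreal (t / 2) < g x} t \<partial>M)"
    proof (cases "0 \<le> t")
      case True
      have [measurable]: "{x. ennreal t < max_fun M g x} \<in> sets M"
        using sets open_max_fun_superlevel borel_open by blast
      have "(\<integral>\<^sup>+x. ennreal (2 * t) * indicator {t. 0 \<le> t \<and> ennreal t < max_fun M g x} t \<partial>M)
        = (\<integral>\<^sup>+x. ennreal (2 * t) * indicator {x. ennreal t < max_fun M g x} x \<partial>M)"
        using True by (simp add: indicator_def)
      also have "\<dots> = ennreal (2 * t) * emeasure M {x. ennreal t < max_fun M g x}"
        by (rule nn_integral_cmult_indicator) measurable
      finally show ?thesis using weak[OF True] by simp
    qed simp
  qed
  also have "\<dots> = 8 * (\<integral>\<^sup>+t. \<integral>\<^sup>+x. g x * indicator {t. 0 \<le> t \<and> ennreal (t / 2) < g x} t \<partial>M \<partial>lborel)"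
    by (intro nn_integral_cmult) measurable
  also have "\<dots> = 8 * (\<integral>\<^sup>+x. \<integral>\<^sup>+t. g x * indicator {t. 0 \<le> t \<and> ennreal (t / 2) < g x} t \<partial>lborel \<partial>M)"
    by (subst Fubini') measurable
  also have "\<dots> = 8 * (\<integral>\<^sup>+x. 2 * (g x)\<^sup>2 \<partial>M)"
  proof -
    have "(\<integral>\<^sup>+t. g x * indicator {t. 0 \<le> t \<and> ennreal (t / 2) < g x} t \<partial>lborel) = 2 * (g x)\<^sup>2" for x
      by (subst nn_integral_cmult_indicator)
         (auto simp: emeasure_ennreal_half_less power2_eq_square mult_ac)
    then show ?thesis by simp
  qed
  also have "\<dots> = 16 * (\<integral>\<^sup>+x. (g x)\<^sup>2 \<partial>M)"
    by (subst nn_integral_cmult) (auto simp flip: mult.assoc)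
  finally show ?thesis .
qed

section \<open>The upper bound\<close>

lemma bdd_interval_endpoints:
  assumes "bdd_interval I"
  obtains a b where "a < b" "{a<..<b} \<subseteq> I" "I \<subseteq> {a..b}"
proof -
  have I: "is_interval I" "bounded I" "0 < emeasure lebesgue I"
    using assms by (auto simp: bdd_interval_def)
  have ne: "I \<noteq> {}" using I(3) by auto
  have bd: "bdd_above I" "bdd_below I"
    using I(2) by (auto intro: bounded_imp_bdd_above bounded_imp_bdd_below)
  have sub: "I \<subseteq> {Inf I..Sup I}"
    using bd by (auto intro: cInf_lower cSup_upper)
  have sub2: "{Inf I<..<Sup I} \<subseteq> I"
  proof
    fix x assume x: "x \<in> {Inf I<..<Sup I}"
    obtain y z where "y \<in> I" "y < x" "z \<in> I" "x < z"
      using x cInf_less_iff[OF ne bd(2)] less_cSup_iff[OF ne bd(1)] by auto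
    then show "x \<in> I" using I(1) unfolding is_interval_1 by (meson less_imp_le)
  qed
  have "Inf I < Sup I"
  proof (rule ccontr)
    assume "\<not> Inf I < Sup I"
    then have "I \<subseteq> {Inf I}" using sub by force
    then have "emeasure lebesgue I \<le> emeasure lebesgue {Inf I}"
      by (intro emeasure_mono) auto
    then show False using I(3) by simp
  qed
  then show ?thesis using that sub sub2 by blast
qed

lemma interval_sym_diff_null:
  fixes a b :: real
  assumes "{a<..<b} \<subseteq> I" "I \<subseteq> {a..b}"
  shows "AE x in lebesgue. x \<in> I \<longleftrightarrow> x \<in> {a<..<b}"
proof -
  have "AE x in lborel. x \<noteq> a \<and> x \<noteq> b"
    using AE_lborel_singleton[of a] AE_lborel_singleton[of b] by eventually_elim simp
  then have "AE x in lebesgue. x \<noteq> a \<and> x \<noteq> b" by (rule AE_completion)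
  then show ?thesis
  proof eventually_elim
    case (elim x)
    have "x \<in> I \<Longrightarrow> a \<le> x \<and> x \<le> b" using assms(2) by auto
    moreover have "a < x \<Longrightarrow> x < b \<Longrightarrow> x \<in> I" using assms(1) by auto
    ultimately show ?case using elim by fastforce
  qed
qed

lemma set_nn_integral_interval_eq:
  fixes a b :: real
  assumes "{a<..<b} \<subseteq> I" "I \<subseteq> {a..b}"
  shows "(\<integral>\<^sup>+x\<in>I. f x \<partial>lebesgue) = (\<integral>\<^sup>+x\<in>{a<..<b}. f x \<partial>lebesgue)"
proof (rule nn_integral_cong_AE)
  show "AE x in lebesgue. f x * indicator I x = f x * indicator {a<..<b} x"
    using interval_sym_diff_null[OF assms] by eventually_elim (simp add: indicator_def)
qed

lemma interval_sets_lebesgue: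
  fixes a b :: real
  assumes "{a<..<b} \<subseteq> I" "I \<subseteq> {a..b}"
  shows "I \<in> sets lebesgue"
proof -
  have "I = {a<..<b} \<union> (I \<inter> {a, b})" using assms by (auto simp: less_le)
  moreover have "I \<inter> {a, b} \<in> sets lebesgue"
    by (intro sets_completionI_sets) (auto intro: borel_closed finite_imp_closed)
  ultimately show ?thesis by (metis lmeasurable_interval(2) sets.Un fmeasurableD)
qed

lemma emeasure_interval_eq:
  fixes a b :: real
  assumes "a < b" "{a<..<b} \<subseteq> I" "I \<subseteq> {a..b}"
  shows "emeasure lebesgue I = ennreal (b - a)"
proof -
  have "emeasure lebesgue I = (\<integral>\<^sup>+x\<in>I. 1 \<partial>lebesgue)"
    using interval_sets_lebesgue[OF assms(2,3)] by (simp add: nn_integral_indicator)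
  also have "\<dots> = (\<integral>\<^sup>+x\<in>{a<..<b}. 1 \<partial>lebesgue)"
    by (rule set_nn_integral_interval_eq[OF assms(2,3)])
  also have "\<dots> = ennreal (b - a)"
    using assms(1) by (simp add: nn_integral_indicator)
  finally show ?thesis .
qed

lemma bdd_interval_greaterThanLessThan: "a < b \<Longrightarrow> bdd_interval {a<..<b}"
  by (auto simp: bdd_interval_def is_interval_1)

lemma sigma_finite_lebesgue: "sigma_finite_measure (lebesgue :: real measure)"
proof
  have "\<exists>n::nat. - real n < x \<and> x < real n" for x :: real
    using reals_Archimedean2[of "\<bar>x\<bar>"] by (auto simp: abs_less_iff minus_less_iff)
  then have UN: "(\<Union>n::nat. {- real n<..<real n}) = UNIV" by auto
  show "\<exists>A :: real set set. countable A \<and> A \<subseteq> sets lebesgue \<and> \<Union>A = space lebesgue \<and> (\<forall>a\<in>A. emeasure lebesgue a \<noteq> \<infinity>)"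
    by (rule exI[of _ "range (\<lambda>n::nat. {- real n<..<real n})"])
       (auto simp: UN)
qed

lemma max_fun_ge:
  assumes "a < x" "x < b" "emeasure M {a<..<b} \<noteq> 0" "emeasure M {a<..<b} \<noteq> \<infinity>"
  shows "(\<integral>\<^sup>+y\<in>{a<..<b}. g y \<partial>M) \<le> emeasure M {a<..<b} * max_fun M g x"
proof -
  have "(\<integral>\<^sup>+y\<in>{a<..<b}. g y \<partial>M) = emeasure M {a<..<b} * ((\<integral>\<^sup>+y\<in>{a<..<b}. g y \<partial>M) / emeasure M {a<..<b})"
    using assms(3,4) by (metis ennreal_divide_times ennreal_mult_divide_eq infinity_ennreal_def mult.commute mult.right_neutral)
  also have "\<dots> \<le> emeasure M {a<..<b} * max_fun M g x"
    by (intro mult_left_mono max_fun_upper assms) simp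
  finally show ?thesis .
qed

lemma borel_measurable_max_fun_lebesgue [measurable]: "max_fun M g \<in> borel_measurable lebesgue"
  by (intro measurable_completion) simp

lemma greaterThanLessThan_sets_lebesgue [measurable]: "{a<..<b :: real} \<in> sets lebesgue"
  by simp

lemma ennreal_mult_divide_cancel_right:
  fixes x :: ennreal
  shows "0 < c \<Longrightarrow> x * ennreal c / ennreal c = x"
  by (rule ennreal_mult_divide_eq) auto

lemma length_mult_le_integral:
  assumes "a < b" "\<And>x. a < x \<Longrightarrow> x < b \<Longrightarrow> c \<le> h x"
  shows "ennreal (b - a) * c \<le> (\<integral>\<^sup>+x\<in>{a<..<b}. h x \<partial>lebesgue)"
proof -
  have "ennreal (b - a) * c = (\<integral>\<^sup>+x. c * indicator {a<..<b} x \<partial>lebesgue)"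
    using assms(1) by (subst nn_integral_cmult_indicator) (auto simp: mult.commute)
  also have "\<dots> \<le> (\<integral>\<^sup>+x\<in>{a<..<b}. h x \<partial>lebesgue)"
    using assms(2) by (intro nn_integral_mono) (auto simp: indicator_def)
  finally show ?thesis .
qed

lemma set_nn_integral_positive_neq_0:
  fixes h :: "real \<Rightarrow> ennreal"
  assumes "a < b" "\<And>x. 0 < h x" and [measurable]: "h \<in> borel_measurable lebesgue"
  shows "(\<integral>\<^sup>+x\<in>{a<..<b}. h x \<partial>lebesgue) \<noteq> 0"
proof
  assume "(\<integral>\<^sup>+x\<in>{a<..<b}. h x \<partial>lebesgue) = 0"
  then have "AE x in lebesgue. h x * indicator {a<..<b} x = 0"
    by (subst (asm) nn_integral_0_iff_AE) auto
  then have "AE x in lebesgue. x \<notin> {a<..<b}"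
  proof eventually_elim
    case (elim x)
    then show ?case using assms(2)[of x] by (auto simp: indicator_def split: if_splits)
  qed
  then have "emeasure lebesgue {a<..<b} = 0"
    by (subst (asm) AE_iff_measurable[of "{a<..<b}"]) auto
  then show False using assms(1) by simp
qed

lemma sigma_finite_density_lebesgue:
  fixes h :: "real \<Rightarrow> real"
  assumes "h \<in> borel_measurable lebesgue"
  shows "sigma_finite_measure (density lebesgue (\<lambda>x. ennreal (h x)))"
  using sigma_finite_measure.sigma_finite_iff_density_finite[OF sigma_finite_lebesgue, of "\<lambda>x. ennreal (h x)"] assms
  by simp

text \<open>The A2 condition is multiplied out and restricted to open intervals, so that lengths
  appear as finite positive factors to be cancelled at the end of each estimate. Later K is
  \<open>A2_const w\<close>.\<close>

locale a2_bound =
  fixes w :: "real \<Rightarrow> real" and K :: ennreal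
  assumes w_meas [measurable]: "w \<in> borel_measurable lebesgue"
    and w_pos: "\<And>x. 0 < w x"
    and K_finite: "K \<noteq> \<infinity>"
    and a2: "\<And>a b. a < b \<Longrightarrow>
      (\<integral>\<^sup>+x\<in>{a<..<b}. ennreal (w x) \<partial>lebesgue) * (\<integral>\<^sup>+x\<in>{a<..<b}. ennreal (inverse (w x)) \<partial>lebesgue)
        \<le> K * (ennreal (b - a))\<^sup>2"
begin

abbreviation "\<mu> \<equiv> density lebesgue (\<lambda>x. ennreal (w x))"
abbreviation "\<nu> \<equiv> density lebesgue (\<lambda>x. ennreal (inverse (w x)))"

lemma w_inverse [simp]: "ennreal (w x) * ennreal (inverse (w x)) = 1"
  using w_pos[of x] by (simp flip: ennreal_mult')

lemma inverse_w [simp]: "ennreal (inverse (w x)) * ennreal (w x) = 1"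
  using w_inverse[of x] by (simp add: mult.commute)

lemma mu_interval: "emeasure \<mu> {a<..<b} = (\<integral>\<^sup>+x\<in>{a<..<b}. ennreal (w x) \<partial>lebesgue)"
  by (subst emeasure_density) auto

lemma nu_interval: "emeasure \<nu> {a<..<b} = (\<integral>\<^sup>+x\<in>{a<..<b}. ennreal (inverse (w x)) \<partial>lebesgue)"
  by (subst emeasure_density) auto

lemma mu_nu_le: "a < b \<Longrightarrow> emeasure \<mu> {a<..<b} * emeasure \<nu> {a<..<b} \<le> K * (ennreal (b - a))\<^sup>2"
  unfolding mu_interval nu_interval by (rule a2)

lemma mu_nonzero: "a < b \<Longrightarrow> emeasure \<mu> {a<..<b} \<noteq> 0"
  unfolding mu_interval by (rule set_nn_integral_positive_neq_0) (auto simp: w_pos)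

lemma nu_nonzero: "a < b \<Longrightarrow> emeasure \<nu> {a<..<b} \<noteq> 0"
  unfolding nu_interval by (rule set_nn_integral_positive_neq_0) (auto simp: w_pos)

lemma mu_nu_finite: "a < b \<Longrightarrow> emeasure \<mu> {a<..<b} * emeasure \<nu> {a<..<b} < \<infinity>"
proof -
  assume "a < b"
  then have "emeasure \<mu> {a<..<b} * emeasure \<nu> {a<..<b} \<le> K * (ennreal (b - a))\<^sup>2" by (rule mu_nu_le)
  also have "\<dots> < \<infinity>" using K_finite by (simp add: ennreal_mult_less_top power2_eq_square less_top)
  finally show ?thesis .
qed

text \<open>The product with the \<open>\<nu>\<close>-mass is finite and that mass is nonzero: the
  A2 condition itself forces local integrability of w, and symmetrically of 1/w.\<close>

lemma mu_finite: "a < b \<Longrightarrow> emeasure \<mu> {a<..<b} \<noteq> \<infinity>"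
  using mu_nu_finite[of a b] nu_nonzero[of a b] by (auto simp: ennreal_mult_less_top)

lemma nu_finite: "a < b \<Longrightarrow> emeasure \<nu> {a<..<b} \<noteq> \<infinity>"
  using mu_nu_finite[of a b] mu_nonzero[of a b] by (auto simp: ennreal_mult_less_top)

lemma sets_mu: "sets borel \<subseteq> sets \<mu>" and sets_nu: "sets borel \<subseteq> sets \<nu>"
  by auto

lemma max_fun_mu_L2:
  assumes [measurable]: "g \<in> borel_measurable lebesgue"
  shows "(\<integral>\<^sup>+x. (max_fun \<mu> g x)\<^sup>2 * ennreal (w x) \<partial>lebesgue) \<le> 16 * (\<integral>\<^sup>+x. (g x)\<^sup>2 * ennreal (w x) \<partial>lebesgue)"
  using max_fun_L2_bound[of \<mu> g, OF sets_mu _ sigma_finite_density_lebesgue[OF w_meas]]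
  by (simp add: nn_integral_density mult.commute)

text \<open>Multiplication by w is an isometry from L2(\<mu>) onto L2(\<nu>), because (g w)^2 / w =
  g^2 w.\<close>

lemma max_fun_nu_L2:
  assumes [measurable]: "g \<in> borel_measurable lebesgue"
  shows "(\<integral>\<^sup>+x. (max_fun \<nu> (\<lambda>y. g y * ennreal (w y)) x)\<^sup>2 * ennreal (inverse (w x)) \<partial>lebesgue)
    \<le> 16 * (\<integral>\<^sup>+x. (g x)\<^sup>2 * ennreal (w x) \<partial>lebesgue)"
proof -
  have *: "(g x * ennreal (w x))\<^sup>2 * ennreal (inverse (w x)) = (g x)\<^sup>2 * ennreal (w x)" for x
  proof -
    have "(g x * ennreal (w x))\<^sup>2 * ennreal (inverse (w x)) =
        (g x)\<^sup>2 * ennreal (w x) * (ennreal (w x) * ennreal (inverse (w x)))"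
      by (simp only: power2_eq_square mult_ac)
    then show ?thesis by simp
  qed
  have "sigma_finite_measure \<nu>" by (rule sigma_finite_density_lebesgue) measurable
  then show ?thesis
    using max_fun_L2_bound[of \<nu> "\<lambda>y. g y * ennreal (w y)", OF sets_nu]
    by (simp add: nn_integral_density mult.commute[of "ennreal (inverse _)"] *)
qed

text \<open>The function H of the overview, with u in place of |f|. The factors w and 1/w turn the
  inner and outer integrals back into Lebesgue integrals, since w d\<nu> = dx and (1/w) d\<mu> =
  dx.\<close>

definition majorant :: "(real \<Rightarrow> ennreal) \<Rightarrow> real \<Rightarrow> ennreal" where
  "majorant u = max_fun \<mu> (\<lambda>y. max_fun \<nu> (\<lambda>z. u z * ennreal (w z)) y * ennreal (inverse (w y)))"

lemma majorant_measurable [measurable]: "majorant u \<in> borel_measurable lebesgue"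
  unfolding majorant_def by measurable

lemma nu_integral_times_w:
  assumes [measurable]: "u \<in> borel_measurable lebesgue"
  shows "(\<integral>\<^sup>+y\<in>{a<..<b}. u y * ennreal (w y) \<partial>\<nu>) = (\<integral>\<^sup>+y\<in>{a<..<b}. u y \<partial>lebesgue)"
proof -
  have *: "ennreal (inverse (w x)) * (u x * ennreal (w x) * i) = u x * i" for x i
  proof -
    have "ennreal (inverse (w x)) * (u x * ennreal (w x) * i) =
       (ennreal (inverse (w x)) * ennreal (w x)) * (u x * i)" by (simp only: mult_ac)
    then show ?thesis by simp
  qed
  show ?thesis by (subst nn_integral_density) (auto simp: *)
qed

lemma mu_integral_divide_w:
  assumes [measurable]: "u \<in> borel_measurable lebesgue"
  shows "(\<integral>\<^sup>+y\<in>{a<..<b}. u y * ennreal (inverse (w y)) \<partial>\<mu>) = (\<integral>\<^sup>+y\<in>{a<..<b}. u y \<partial>lebesgue)"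
proof -
  have *: "ennreal (w x) * (u x * ennreal (inverse (w x)) * i) = u x * i" for x i
  proof -
    have "ennreal (w x) * (u x * ennreal (inverse (w x)) * i) =
       (ennreal (w x) * ennreal (inverse (w x))) * (u x * i)" by (simp only: mult_ac)
    then show ?thesis by simp
  qed
  show ?thesis by (subst nn_integral_density) (auto simp: *)
qed

lemma integral_le_nu_max_fun:
  assumes [measurable]: "u \<in> borel_measurable lebesgue" and "a < x" "x < b"
  shows "(\<integral>\<^sup>+y\<in>{a<..<b}. u y \<partial>lebesgue) \<le> emeasure \<nu> {a<..<b} * max_fun \<nu> (\<lambda>z. u z * ennreal (w z)) x"
  using max_fun_ge[of a x b \<nu> "\<lambda>z. u z * ennreal (w z)"] assms nu_finite[of a b] nu_nonzero[of a b]
  by (simp add: nu_integral_times_w)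

text \<open>Write I for the interval and \<Phi> for the inner maximal function. The integral of u
  over I is at most \<nu>(I) \<Phi>(y) for every y in I. Averaging over y replaces \<Phi>(y) by the
  Lebesgue integral of \<Phi> over I, which is the \<open>\<mu>\<close>-integral of \<Phi>/w and
  hence at most \<mu>(I) H(x). The product \<mu>(I) \<nu>(I) is then absorbed by K |I|^2.\<close>

lemma average_le_majorant:
  assumes [measurable]: "u \<in> borel_measurable lebesgue" and x: "a < x" "x < b"
  shows "(\<integral>\<^sup>+y\<in>{a<..<b}. u y \<partial>lebesgue) / ennreal (b - a) \<le> K * majorant u x"
proof -
  let ?L = "ennreal (b - a)" and ?A = "\<integral>\<^sup>+y\<in>{a<..<b}. u y \<partial>lebesgue"
  let ?\<Phi> = "max_fun \<nu> (\<lambda>z. u z * ennreal (w z))"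
  have ab: "a < b" using x by simp
  have "?L * ?A \<le> (\<integral>\<^sup>+x\<in>{a<..<b}. emeasure \<nu> {a<..<b} * ?\<Phi> x \<partial>lebesgue)"
    by (intro length_mult_le_integral integral_le_nu_max_fun ab) auto
  also have "\<dots> = emeasure \<nu> {a<..<b} * (\<integral>\<^sup>+x\<in>{a<..<b}. ?\<Phi> x \<partial>lebesgue)"
    by (simp add: mult.assoc nn_integral_cmult)
  also have "\<dots> \<le> emeasure \<nu> {a<..<b} * (emeasure \<mu> {a<..<b} * majorant u x)"
  proof (rule mult_left_mono)
    have "(\<integral>\<^sup>+x\<in>{a<..<b}. ?\<Phi> x \<partial>lebesgue) = (\<integral>\<^sup>+x\<in>{a<..<b}. ?\<Phi> x * ennreal (inverse (w x)) \<partial>\<mu>)"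
      by (rule mu_integral_divide_w[symmetric]) simp
    also have "\<dots> \<le> emeasure \<mu> {a<..<b} * majorant u x"
      unfolding majorant_def using ab mu_nonzero mu_finite by (intro max_fun_ge x) auto
    finally show "(\<integral>\<^sup>+x\<in>{a<..<b}. ?\<Phi> x \<partial>lebesgue) \<le> emeasure \<mu> {a<..<b} * majorant u x" .
  qed simp
  also have "\<dots> = (emeasure \<mu> {a<..<b} * emeasure \<nu> {a<..<b}) * majorant u x" by (simp only: mult_ac)
  also have "\<dots> \<le> (K * ?L\<^sup>2) * majorant u x"
    by (intro mult_right_mono mu_nu_le ab) simp
  finally have "?A * ?L \<le> (K * majorant u x * ?L) * ?L"
    by (simp add: power2_eq_square mult_ac)
  then have "(?A * ?L) / ?L / ?L \<le> (K * majorant u x * ?L) * ?L / ?L / ?L"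
    by (intro divide_right_mono_ennreal)
  then show ?thesis using ab by (simp add: ennreal_mult_divide_cancel_right)
qed

text \<open>Every interval competing in \<open>max_avg A f\<close> contains x, so the single value
  of the uncentred majorant at x controls them all. Enlarging intervals beyond A therefore costs
  nothing more.\<close>

lemma max_avg_le_majorant:
  assumes [measurable]: "f \<in> borel_measurable lebesgue"
    and A: "{a<..<b} \<subseteq> A" and x: "a < x" "x < b"
  shows "max_avg A f \<le> K * majorant (\<lambda>y. ennreal \<bar>f y\<bar>) x"
  unfolding max_avg_def
proof (rule SUP_least, clarify)
  fix I assume I: "bdd_interval I" "A \<subseteq> I"
  obtain c d where cd: "c < d" "{c<..<d} \<subseteq> I" "I \<subseteq> {c..d}"
    using bdd_interval_endpoints[OF I(1)] by metis
  have "{a<..<b} \<subseteq> {c..d}" using A I(2) cd(3) by blast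
  then have "c \<le> a" "b \<le> d" using x by (simp_all add: greaterThanLessThan_subseteq_atLeastAtMost_iff)
  then have "(\<integral>\<^sup>+y\<in>{c<..<d}. ennreal \<bar>f y\<bar> \<partial>lebesgue) / ennreal (d - c) \<le> K * majorant (\<lambda>y. ennreal \<bar>f y\<bar>) x"
    using x by (intro average_le_majorant) auto
  then show "interval_avg f I \<le> K * majorant (\<lambda>y. ennreal \<bar>f y\<bar>) x"
    by (simp add: interval_avg_def emeasure_interval_eq[OF cd] set_nn_integral_interval_eq[OF cd(2,3)])
qed

lemma majorant_L2:
  assumes [measurable]: "u \<in> borel_measurable lebesgue"
  shows "(\<integral>\<^sup>+x. (majorant u x)\<^sup>2 * ennreal (w x) \<partial>lebesgue) \<le> 256 * (\<integral>\<^sup>+x. (u x)\<^sup>2 * ennreal (w x) \<partial>lebesgue)"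
proof -
  let ?\<Phi> = "max_fun \<nu> (\<lambda>z. u z * ennreal (w z))"
  have *: "(?\<Phi> x * ennreal (inverse (w x)))\<^sup>2 * ennreal (w x) = (?\<Phi> x)\<^sup>2 * ennreal (inverse (w x))" for x
  proof -
    have "(?\<Phi> x * ennreal (inverse (w x)))\<^sup>2 * ennreal (w x)
      = (?\<Phi> x)\<^sup>2 * ennreal (inverse (w x)) * (ennreal (inverse (w x)) * ennreal (w x))"
      by (simp only: power2_eq_square mult_ac)
    then show ?thesis by simp
  qed
  have "(\<integral>\<^sup>+x. (majorant u x)\<^sup>2 * ennreal (w x) \<partial>lebesgue)
      \<le> 16 * (\<integral>\<^sup>+x. (?\<Phi> x)\<^sup>2 * ennreal (inverse (w x)) \<partial>lebesgue)"
    unfolding majorant_def using max_fun_mu_L2[of "\<lambda>y. ?\<Phi> y * ennreal (inverse (w y))"] by (simp add: *)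
  also have "\<dots> \<le> 16 * (16 * (\<integral>\<^sup>+x. (u x)\<^sup>2 * ennreal (w x) \<partial>lebesgue))"
    by (intro mult_left_mono max_fun_nu_L2) auto
  finally show ?thesis by (simp flip: mult.assoc)
qed

end

section \<open>Norms and suprema in \<open>ennreal\<close>, and countability of sparse
  families\<close>

lemma ennreal_sqrt_power2 [simp]: "(ennreal_sqrt x)\<^sup>2 = x"
  by (cases x) (auto simp: ennreal_sqrt_def ennreal_power power2_eq_square[of top])

lemma ennreal_power2_le_imp_le: "(a::ennreal)\<^sup>2 \<le> b\<^sup>2 \<Longrightarrow> a \<le> b"
proof (rule ccontr)
  assume le: "a\<^sup>2 \<le> b\<^sup>2" and "\<not> a \<le> b"
  then have lt: "b < a" by simp
  then obtain r where r: "b = ennreal r" "0 \<le> r" by (cases b) auto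
  show False
  proof (cases a)
    case (real s)
    then have "s\<^sup>2 \<le> r\<^sup>2" "r < s" using le lt r by (auto simp: ennreal_power ennreal_less_iff)
    then show False using r(2) power_strict_mono[of r s 2] by simp
  next
    case top
    then show False using le r by (simp add: ennreal_power power2_eq_square top_unique flip: ennreal_mult)
  qed
qed

lemma ennreal_mult_divide_le: "(c::ennreal) * b / b \<le> c"
proof (cases "b = 0 \<or> b = \<infinity>")
  case True
  then show ?thesis by (auto simp: ennreal_divide_top)
next
  case False
  then show ?thesis by (simp add: ennreal_mult_divide_eq)
qed

lemma L2_op_norm_le:
  assumes "\<And>f. f \<in> L2_space w \<Longrightarrow>
    (\<integral>\<^sup>+x. (T f x)\<^sup>2 * ennreal (w x) \<partial>lebesgue) \<le> c\<^sup>2 * (\<integral>\<^sup>+x. (ennreal \<bar>f x\<bar>)\<^sup>2 * ennreal (w x) \<partial>lebesgue)"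
  shows "L2_op_norm w T \<le> c"
  unfolding L2_op_norm_def
proof (rule SUP_least, clarify)
  fix f assume f: "f \<in> L2_space w"
  have "(L2_norm w (T f))\<^sup>2 \<le> (c * L2_norm w (\<lambda>x. ennreal \<bar>f x\<bar>))\<^sup>2"
    using assms[OF f] by (simp add: L2_norm_def power_mult_distrib)
  then have "L2_norm w (T f) \<le> c * L2_norm w (\<lambda>x. ennreal \<bar>f x\<bar>)" by (rule ennreal_power2_le_imp_le)
  then have "L2_norm w (T f) / L2_norm w (\<lambda>x. ennreal \<bar>f x\<bar>)
      \<le> c * L2_norm w (\<lambda>x. ennreal \<bar>f x\<bar>) / L2_norm w (\<lambda>x. ennreal \<bar>f x\<bar>)"
    by (rule divide_right_mono_ennreal)
  also have "\<dots> \<le> c" by (rule ennreal_mult_divide_le)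
  finally show "L2_norm w (T f) / L2_norm w (\<lambda>x. ennreal \<bar>f x\<bar>) \<le> c" .
qed

lemma L2_space_finite:
  "f \<in> L2_space w \<Longrightarrow> (\<integral>\<^sup>+x. (ennreal \<bar>f x\<bar>)\<^sup>2 * ennreal (w x) \<partial>lebesgue) < \<infinity>"
  by (auto simp: L2_space_def L2_norm_def ennreal_sqrt_def less_top split: if_splits)

lemma AE_lebesgue_ex_interval:
  assumes "AE x in lebesgue. P x" "a < (b::real)"
  shows "\<exists>x. a < x \<and> x < b \<and> P x"
proof (rule ccontr)
  assume "\<not> ?thesis"
  then have *: "P x \<Longrightarrow> x \<notin> {a<..<b}" for x by auto
  have "AE x in lebesgue. x \<notin> {a<..<b}" using assms(1) by eventually_elim (rule *)
  then have "emeasure lebesgue {a<..<b} = 0"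
    by (subst (asm) AE_iff_measurable[of "{a<..<b}"]) auto
  then show False using assms(2) by simp
qed

lemma SUP_power2_ennreal:
  fixes s :: "nat \<Rightarrow> ennreal"
  assumes "incseq s"
  shows "(SUP n. s n)\<^sup>2 = (SUP n. (s n)\<^sup>2)"
proof (rule antisym)
  have "(SUP n. s n)\<^sup>2 = (SUP m. SUP n. s n * s m)"
    by (simp add: power2_eq_square SUP_mult_left_ennreal SUP_mult_right_ennreal)
  also have "\<dots> \<le> (SUP n. (s n)\<^sup>2)"
  proof (intro SUP_least)
    fix m n
    have "s n * s m \<le> s (max n m) * s (max n m)"
      using assms by (intro mult_mono) (auto simp: incseq_def)
    then show "s n * s m \<le> (SUP n. (s n)\<^sup>2)"
      by (intro SUP_upper2[of "max n m"]) (auto simp: power2_eq_square)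
  qed
  finally show "(SUP n. s n)\<^sup>2 \<le> (SUP n. (s n)\<^sup>2)" .
  show "(SUP n. (s n)\<^sup>2) \<le> (SUP n. s n)\<^sup>2"
    by (intro SUP_least power_mono SUP_upper) auto
qed

lemma infsum_range_eq_SUP:
  fixes f :: "'a \<Rightarrow> ennreal"
  assumes "S = range (e :: nat \<Rightarrow> 'a)"
  shows "infsum f S = (SUP n. sum f (e ` {..n}))"
proof -
  have "infsum f S = (SUP F\<in>{F. finite F \<and> F \<subseteq> S}. sum f F)"
    by (rule nonneg_infsum_complete) simp
  also have "\<dots> = (SUP n. sum f (e ` {..n}))"
  proof (rule antisym)
    show "(SUP F\<in>{F. finite F \<and> F \<subseteq> S}. sum f F) \<le> (SUP n. sum f (e ` {..n}))"
    proof (rule SUP_least, clarify)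
      fix F assume F: "finite F" "F \<subseteq> S"
      obtain N where N: "finite N" "F = e ` N"
        using finite_subset_image[of F e UNIV] F assms by blast
      obtain n where "N \<subseteq> {..n}" using N(1) finite_nat_iff_bounded_le by auto
      then have "sum f F \<le> sum f (e ` {..n})" unfolding N(2) by (intro sum_mono2) auto
      then show "sum f F \<le> (SUP n. sum f (e ` {..n}))" by (rule SUP_upper2[rotated]) simp
    qed
    show "(SUP n. sum f (e ` {..n})) \<le> (SUP F\<in>{F. finite F \<and> F \<subseteq> S}. sum f F)"
      using assms by (intro SUP_least SUP_upper) auto
  qed
  finally show ?thesis .
qed

text \<open>The sets E A are disjoint and of positive measure. Their traces on (-n, n) have total
  measure at most 2 n, so only countably many traces are non-null for each n, and every E A has a
  non-null trace for some n. Countability is what makes monotone convergence available for the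
  operator.\<close>

lemma gamma_sparse_countable:
  assumes "0 < \<gamma>" "gamma_sparse \<gamma> S"
  shows "countable S"
proof -
  have bdd: "\<And>A. A \<in> S \<Longrightarrow> bdd_interval A" using assms(2) by (simp add: gamma_sparse_def)
  obtain E where E0: "\<forall>A\<in>S. E A \<in> sets lebesgue \<and> E A \<subseteq> A \<and> ennreal \<gamma> * emeasure lebesgue A \<le> emeasure lebesgue (E A)"
     "disjoint_family_on E S"
    using assms(2) unfolding gamma_sparse_def by blast
  have E: "\<And>A. A \<in> S \<Longrightarrow> E A \<in> sets lebesgue"
     "\<And>A. A \<in> S \<Longrightarrow> ennreal \<gamma> * emeasure lebesgue A \<le> emeasure lebesgue (E A)"
     "disjoint_family_on E S"
    using E0 by blast+
  define h where "h = (\<lambda>(n::nat) A. measure lebesgue (E A \<inter> {- real n<..<real n}))"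
  have fm: "{- real n<..<real n} \<in> lmeasurable" for n by simp
  have lm: "E A \<inter> {- real n<..<real n} \<in> lmeasurable" if "A \<in> S" for A n
    using E(1)[OF that] fm by (intro fmeasurable_Int_fmeasurable[of "{- real n<..<real n}" _ "E A", simplified Int_commute]) auto
  have fin: "sum (h n) F \<le> 2 * real n" if F: "finite F" "F \<subseteq> S" for n F
  proof -
    have "sum (h n) F = measure lebesgue (\<Union>A\<in>F. E A \<inter> {- real n<..<real n})"
      unfolding h_def
    proof (intro measure_finite_Union[symmetric] F(1))
      show "(\<lambda>A. E A \<inter> {- real n<..<real n}) ` F \<subseteq> sets lebesgue"
        using lm F(2) by (auto intro: fmeasurableD)
      show "disjoint_family_on (\<lambda>A. E A \<inter> {- real n<..<real n}) F"
        using E(3) F(2) unfolding disjoint_family_on_def by blast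
      show "emeasure lebesgue (E A \<inter> {- real n<..<real n}) \<noteq> \<infinity>" if "A \<in> F" for A
        using fmeasurableD2[OF lm[of A n]] that F(2) by auto
    qed
    also have "\<dots> \<le> measure lebesgue {- real n<..<real n}"
      using F lm by (intro measure_mono_fmeasurable sets.finite_UN) auto
    finally show ?thesis by simp
  qed
  have "h n summable_on S" for n
    using fin by (intro nonneg_bdd_above_summable_on bdd_aboveI2[of _ _ "2 * real n"]) (auto simp: h_def)
  then have "countable {A\<in>S. h n A \<noteq> 0}" for n
    by (rule summable_countable_real)
  then have "countable (\<Union>n. {A\<in>S. h n A \<noteq> 0})" by blast
  moreover have "S \<subseteq> (\<Union>n. {A\<in>S. h n A \<noteq> 0})"
  proof
    fix A assume A: "A \<in> S"
    have "0 < ennreal \<gamma> * emeasure lebesgue A"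
      using assms(1) bdd[OF A] by (auto simp: bdd_interval_def ennreal_zero_less_mult_iff)
    then have pos: "0 < emeasure lebesgue (E A)" using E(2)[OF A] by (rule less_le_trans)
    show "A \<in> (\<Union>n. {A\<in>S. h n A \<noteq> 0})"
    proof (rule ccontr)
      assume "A \<notin> (\<Union>n. {A\<in>S. h n A \<noteq> 0})"
      then have h0: "h n A = 0" for n using A by auto
      have "E A \<inter> {- real n<..<real n} \<in> null_sets lebesgue" for n
        using emeasure_eq_measure2[OF lm[OF A, of n]] fmeasurableD[OF lm[OF A, of n]] h0[of n]
        unfolding h_def by (metis ennreal_0 null_setsI)
      then have "(\<Union>n. E A \<inter> {- real n<..<real n}) \<in> null_sets lebesgue" by (rule null_sets_UN)
      moreover have "(\<Union>n. E A \<inter> {- real n<..<real n}) = E A"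
      proof -
        have "\<exists>n::nat. - real n < x \<and> x < real n" for x :: real
          using reals_Archimedean2[of "\<bar>x\<bar>"] by (auto simp: abs_less_iff minus_less_iff)
        then show ?thesis by auto
      qed
      ultimately show False using pos by (simp add: null_sets_def)
    qed
  qed
  ultimately show ?thesis by (rule countable_subset[rotated])
qed

section \<open>Sparse domination by testing the operator against its own output\<close>

context a2_bound
begin

text \<open>With |A| = L and x inside A, integrating \<open>max_avg A f\<close> <= K H over A gives
  L \<open>max_avg A f\<close> <= K \<nu>(A) P x, while the integral of g w over A is at most
  \<mu>(A) Q x. Multiplying and using the A2 condition a second time yields a bound by K^2 L P x Q x
  at every inner point x. Integration over E trades L for |E| >= \<gamma> L.\<close>

lemma sparse_term_bound:
  fixes f :: "real \<Rightarrow> real" and g :: "real \<Rightarrow> ennreal"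
  defines "u \<equiv> \<lambda>y. ennreal \<bar>f y\<bar>"
  defines "P \<equiv> max_fun \<nu> (\<lambda>y. majorant u y * ennreal (w y))" and "Q \<equiv> max_fun \<mu> g"
  assumes f [measurable]: "f \<in> borel_measurable lebesgue" and g [measurable]: "g \<in> borel_measurable lebesgue"
    and A: "bdd_interval A" and E: "E \<in> sets lebesgue" "E \<subseteq> A"
      "ennreal \<gamma> * emeasure lebesgue A \<le> emeasure lebesgue E"
  shows "ennreal \<gamma> * (max_avg A f * (\<integral>\<^sup>+x\<in>A. g x * ennreal (w x) \<partial>lebesgue)) \<le> K\<^sup>2 * (\<integral>\<^sup>+x\<in>E. P x * Q x \<partial>lebesgue)"
proof -
  obtain a b where ab: "a < b" "{a<..<b} \<subseteq> A" "A \<subseteq> {a..b}"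
    using bdd_interval_endpoints[OF A] by metis
  note E(1)[measurable]
  have [measurable]: "u \<in> borel_measurable lebesgue" unfolding u_def by measurable
  have [measurable]: "P \<in> borel_measurable lebesgue" "Q \<in> borel_measurable lebesgue"
    unfolding P_def Q_def by measurable
  let ?L = "ennreal (b - a)" and ?c = "max_avg A f"
  let ?G = "\<integral>\<^sup>+x\<in>{a<..<b}. g x * ennreal (w x) \<partial>lebesgue"
  have L: "emeasure lebesgue A = ?L" by (rule emeasure_interval_eq[OF ab])
  have GA: "(\<integral>\<^sup>+x\<in>A. g x * ennreal (w x) \<partial>lebesgue) = ?G"
    by (rule set_nn_integral_interval_eq[OF ab(2,3)])
  have pt: "?c * ?G \<le> K\<^sup>2 * ?L * (P x * Q x)" if x: "a < x" "x < b" for x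
  proof -
    have "?L * ?c \<le> (\<integral>\<^sup>+x\<in>{a<..<b}. K * majorant u x \<partial>lebesgue)"
      unfolding u_def by (intro length_mult_le_integral max_avg_le_majorant[OF f ab(2)] ab(1))
    also have "\<dots> = K * (\<integral>\<^sup>+x\<in>{a<..<b}. majorant u x \<partial>lebesgue)"
      by (simp add: mult.assoc nn_integral_cmult)
    also have "\<dots> \<le> K * (emeasure \<nu> {a<..<b} * P x)"
      unfolding P_def by (intro mult_left_mono integral_le_nu_max_fun x) auto
    finally have 1: "?L * ?c \<le> K * (emeasure \<nu> {a<..<b} * P x)" .
    have "?G = (\<integral>\<^sup>+x\<in>{a<..<b}. g x \<partial>\<mu>)"
      by (subst nn_integral_density) (auto simp: mult_ac)
    also have "\<dots> \<le> emeasure \<mu> {a<..<b} * Q x"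
      unfolding Q_def using mu_nonzero[OF ab(1)] mu_finite[OF ab(1)] by (intro max_fun_ge x) auto
    finally have 2: "?G \<le> emeasure \<mu> {a<..<b} * Q x" .
    have "?L * ?c * ?G \<le> K * (emeasure \<nu> {a<..<b} * P x) * (emeasure \<mu> {a<..<b} * Q x)"
      by (intro mult_mono 1 2) auto
    also have "\<dots> = K * (emeasure \<mu> {a<..<b} * emeasure \<nu> {a<..<b}) * (P x * Q x)" by (simp only: mult_ac)
    also have "\<dots> \<le> K * (K * ?L\<^sup>2) * (P x * Q x)"
      by (intro mult_right_mono mult_left_mono mu_nu_le ab(1)) auto
    finally have "(?c * ?G) * ?L \<le> (K\<^sup>2 * ?L * (P x * Q x)) * ?L"
      by (simp add: power2_eq_square mult_ac)
    then have "(?c * ?G) * ?L / ?L \<le> (K\<^sup>2 * ?L * (P x * Q x)) * ?L / ?L"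
      by (rule divide_right_mono_ennreal)
    then show ?thesis using ab(1) by (simp add: ennreal_mult_divide_cancel_right)
  qed
  have "(ennreal \<gamma> * (?c * ?G)) * ?L = (?c * ?G) * (ennreal \<gamma> * ?L)" by (simp only: mult_ac)
  also have "\<dots> \<le> (?c * ?G) * emeasure lebesgue E"
    using E(3) unfolding L by (rule mult_left_mono) simp
  also have "\<dots> = (\<integral>\<^sup>+x. (?c * ?G) * indicator E x \<partial>lebesgue)"
    by (rule nn_integral_cmult_indicator[symmetric]) measurable
  also have "\<dots> \<le> (\<integral>\<^sup>+x. (K\<^sup>2 * ?L) * (P x * Q x * indicator E x) \<partial>lebesgue)"
  proof (rule nn_integral_mono_AE)
    show "AE x in lebesgue. (?c * ?G) * indicator E x \<le> (K\<^sup>2 * ?L) * (P x * Q x * indicator E x)"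
      using interval_sym_diff_null[OF ab(2,3)]
    proof eventually_elim
      case (elim x)
      show ?case
      proof (cases "x \<in> E")
        case True
        then have "a < x" "x < b" using elim E(2) by auto
        then show ?thesis using pt[of x] True by simp
      qed simp
    qed
  qed
  also have "\<dots> = (K\<^sup>2 * (\<integral>\<^sup>+x\<in>E. P x * Q x \<partial>lebesgue)) * ?L"
    by (subst nn_integral_cmult) (auto simp: mult_ac)
  finally have "(ennreal \<gamma> * (?c * ?G)) * ?L / ?L \<le> (K\<^sup>2 * (\<integral>\<^sup>+x\<in>E. P x * Q x \<partial>lebesgue)) * ?L / ?L"
    by (rule divide_right_mono_ennreal)
  then show ?thesis unfolding GA using ab(1) by (simp add: ennreal_mult_divide_cancel_right)
qed

text \<open>Cauchy-Schwarz after inserting 1 = sqrt(1/w) sqrt(w): the duality between L2(\<nu>) and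
  L2(\<mu>) under Lebesgue pairing.\<close>

lemma integral_product_le:
  fixes P Q :: "real \<Rightarrow> ennreal"
  assumes [measurable]: "P \<in> borel_measurable lebesgue" "Q \<in> borel_measurable lebesgue"
  shows "(\<integral>\<^sup>+x. P x * Q x \<partial>lebesgue)\<^sup>2 \<le>
    (\<integral>\<^sup>+x. (P x)\<^sup>2 * ennreal (inverse (w x)) \<partial>lebesgue) * (\<integral>\<^sup>+x. (Q x)\<^sup>2 * ennreal (w x) \<partial>lebesgue)"
proof -
  let ?p = "\<lambda>x. ennreal (sqrt (inverse (w x)))" and ?q = "\<lambda>x. ennreal (sqrt (w x))"
  have pq: "?p x * ?q x = 1" for x
    using w_pos[of x] by (simp add: real_sqrt_inverse flip: ennreal_mult)
  have p2: "(?p x)\<^sup>2 = ennreal (inverse (w x))" and q2: "(?q x)\<^sup>2 = ennreal (w x)" for x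
    using w_pos[of x] by (auto simp: ennreal_power)
  have "P x * Q x = (P x * ?p x) * (Q x * ?q x)" for x
  proof -
    have "(P x * ?p x) * (Q x * ?q x) = (?p x * ?q x) * (P x * Q x)" by (simp only: mult_ac)
    then show ?thesis by (simp add: pq)
  qed
  then have "(\<integral>\<^sup>+x. P x * Q x \<partial>lebesgue)\<^sup>2 = (\<integral>\<^sup>+x. (P x * ?p x) * (Q x * ?q x) \<partial>lebesgue)\<^sup>2" by simp
  also have "\<dots> \<le> (\<integral>\<^sup>+x. (P x * ?p x)\<^sup>2 \<partial>lebesgue) * (\<integral>\<^sup>+x. (Q x * ?q x)\<^sup>2 \<partial>lebesgue)"
    by (rule Cauchy_Schwarz_nn_integral) measurable
  finally show ?thesis by (simp add: power_mult_distrib p2 q2)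
qed

text \<open>The majorant lies in L2(w) and w is positive, so it is finite at some inner point of A,
  and one such point bounds the whole supremum.\<close>

lemma max_avg_finite:
  assumes f [measurable]: "f \<in> borel_measurable lebesgue" and A: "bdd_interval A"
    and fin: "(\<integral>\<^sup>+x. (ennreal \<bar>f x\<bar>)\<^sup>2 * ennreal (w x) \<partial>lebesgue) < \<infinity>"
  shows "max_avg A f < \<infinity>"
proof -
  let ?u = "\<lambda>y. ennreal \<bar>f y\<bar>"
  obtain a b where ab: "a < b" "{a<..<b} \<subseteq> A" "A \<subseteq> {a..b}"
    using bdd_interval_endpoints[OF A] by metis
  have "(\<integral>\<^sup>+x. (majorant ?u x)\<^sup>2 * ennreal (w x) \<partial>lebesgue) \<le> 256 * (\<integral>\<^sup>+x. (?u x)\<^sup>2 * ennreal (w x) \<partial>lebesgue)"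
    by (rule majorant_L2) measurable
  also have "\<dots> < \<infinity>" using fin by (simp add: ennreal_mult_less_top)
  finally have "AE x in lebesgue. (majorant ?u x)\<^sup>2 * ennreal (w x) \<noteq> \<infinity>"
    by (intro nn_integral_PInf_AE) auto
  then obtain x where x: "a < x" "x < b" "(majorant ?u x)\<^sup>2 * ennreal (w x) \<noteq> \<infinity>"
    using AE_lebesgue_ex_interval[OF _ ab(1)] by blast
  have "majorant ?u x \<noteq> \<infinity>"
    using x(3) w_pos[of x] by (auto simp: power2_eq_square ennreal_top_mult)
  then have "K * majorant ?u x < \<infinity>" using K_finite by (simp add: ennreal_mult_less_top less_top)
  with max_avg_le_majorant[OF f ab(2) x(1,2)] show ?thesis by (rule le_less_trans)
qed

text \<open>Finitely many terms keep X finite, so it can be divided out of \<gamma> X <= K^2 *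
  (integral of P Q), where the squared integral is at most (16 * 256 U) * (16 X). Here 256 comes
  from the majorant, each 16 from one more maximal function, and 65536 = 256^2.\<close>

lemma finite_sparse_bound:
  assumes f [measurable]: "f \<in> borel_measurable lebesgue" and \<gamma>: "0 < \<gamma>" and S: "gamma_sparse \<gamma> S"
    and F: "finite F" "F \<subseteq> S"
    and fin: "(\<integral>\<^sup>+x. (ennreal \<bar>f x\<bar>)\<^sup>2 * ennreal (w x) \<partial>lebesgue) < \<infinity>"
  shows "(\<integral>\<^sup>+x. (\<Sum>A\<in>F. max_avg A f * indicator A x)\<^sup>2 * ennreal (w x) \<partial>lebesgue)
    \<le> (ennreal (256 / \<gamma>) * K\<^sup>2)\<^sup>2 * (\<integral>\<^sup>+x. (ennreal \<bar>f x\<bar>)\<^sup>2 * ennreal (w x) \<partial>lebesgue)"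
proof -
  have bdd: "\<And>A. A \<in> S \<Longrightarrow> bdd_interval A" using S by (simp add: gamma_sparse_def)
  obtain E where E0: "\<forall>A\<in>S. E A \<in> sets lebesgue \<and> E A \<subseteq> A \<and> ennreal \<gamma> * emeasure lebesgue A \<le> emeasure lebesgue (E A)"
     "disjoint_family_on E S"
    using S unfolding gamma_sparse_def by blast
  have E: "\<And>A. A \<in> S \<Longrightarrow> E A \<in> sets lebesgue" "\<And>A. A \<in> S \<Longrightarrow> E A \<subseteq> A"
     "\<And>A. A \<in> S \<Longrightarrow> ennreal \<gamma> * emeasure lebesgue A \<le> emeasure lebesgue (E A)"
     "disjoint_family_on E S"
    using E0 by blast+
  have setsA: "A \<in> sets lebesgue" if A: "A \<in> F" for A
    using bdd_interval_endpoints[OF bdd] interval_sets_lebesgue A F(2) by (metis subsetD)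
  define g where "g = (\<lambda>x. \<Sum>A\<in>F. max_avg A f * indicator A x)"
  have g [measurable]: "g \<in> borel_measurable lebesgue"
    unfolding g_def using setsA by (intro borel_measurable_sum borel_measurable_times_ennreal borel_measurable_indicator) auto
  let ?u = "\<lambda>y. ennreal \<bar>f y\<bar>"
  define P where "P = max_fun \<nu> (\<lambda>y. majorant ?u y * ennreal (w y))"
  define Q where "Q = max_fun \<mu> g"
  have [measurable]: "P \<in> borel_measurable lebesgue" "Q \<in> borel_measurable lebesgue"
    unfolding P_def Q_def by measurable
  define X where "X = (\<integral>\<^sup>+x. (g x)\<^sup>2 * ennreal (w x) \<partial>lebesgue)"
  define U where "U = (\<integral>\<^sup>+x. (?u x)\<^sup>2 * ennreal (w x) \<partial>lebesgue)"
  \<comment> \<open>The operator is tested against its own output \<open>g\<close>, so \<open>X\<close> will be cancelled.\<close>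
  have X_finite: "X \<noteq> \<infinity>"
  proof -
    have "bounded (\<Union>F)" using F bdd by (intro bounded_Union) (auto simp: bdd_interval_def)
    then obtain R where R: "0 < R" "\<And>x. x \<in> \<Union>F \<Longrightarrow> norm x < R"
      unfolding bounded_pos_less by blast
    have gle: "g x \<le> (\<Sum>A\<in>F. max_avg A f) * indicator {-R<..<R} x" for x
    proof -
      have "g x \<le> (\<Sum>A\<in>F. max_avg A f * indicator {-R<..<R} x)"
        unfolding g_def using R(2) by (intro sum_mono) (fastforce simp: indicator_def abs_less_iff)
      then show ?thesis by (simp add: sum_distrib_right)
    qed
    have "X \<le> (\<integral>\<^sup>+x. (\<Sum>A\<in>F. max_avg A f)\<^sup>2 * (ennreal (w x) * indicator {-R<..<R} x) \<partial>lebesgue)"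
      unfolding X_def
    proof (intro nn_integral_mono)
      fix x
      have "(g x)\<^sup>2 * ennreal (w x) \<le> ((\<Sum>A\<in>F. max_avg A f) * indicator {-R<..<R} x)\<^sup>2 * ennreal (w x)"
        by (intro mult_right_mono power_mono gle) auto
      also have "\<dots> = (\<Sum>A\<in>F. max_avg A f)\<^sup>2 * (ennreal (w x) * indicator {-R<..<R} x)"
        by (simp add: indicator_def)
      finally show "(g x)\<^sup>2 * ennreal (w x) \<le> (\<Sum>A\<in>F. max_avg A f)\<^sup>2 * (ennreal (w x) * indicator {-R<..<R} x)" .
    qed
    also have "\<dots> = (\<Sum>A\<in>F. max_avg A f)\<^sup>2 * emeasure \<mu> {-R<..<R}"
      unfolding mu_interval by (rule nn_integral_cmult) measurable
    also have "\<dots> < \<infinity>"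
    proof -
      have "(\<Sum>A\<in>F. max_avg A f) < \<infinity>"
        using F bdd max_avg_finite[OF f _ fin] by (simp add: subset_iff)
      moreover have "emeasure \<mu> {-R<..<R} < \<infinity>" using mu_finite[of "-R" R] R(1) by (simp add: less_top)
      ultimately show ?thesis by (simp add: ennreal_mult_less_top power2_eq_square)
    qed
    finally show ?thesis by simp
  qed
  have "ennreal \<gamma> * X = ennreal \<gamma> * (\<Sum>A\<in>F. max_avg A f * (\<integral>\<^sup>+x\<in>A. g x * ennreal (w x) \<partial>lebesgue))"
  proof -
    have "X = (\<integral>\<^sup>+x. (\<Sum>A\<in>F. max_avg A f * (g x * ennreal (w x) * indicator A x)) \<partial>lebesgue)"
    proof -
      have "(g x)\<^sup>2 * ennreal (w x) = (\<Sum>A\<in>F. max_avg A f * (g x * ennreal (w x) * indicator A x))" for x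
      proof -
        have "(g x)\<^sup>2 * ennreal (w x) = (\<Sum>A\<in>F. max_avg A f * indicator A x) * (g x * ennreal (w x))"
          by (simp add: power2_eq_square g_def mult.assoc)
        also have "\<dots> = (\<Sum>A\<in>F. max_avg A f * (g x * ennreal (w x) * indicator A x))"
          unfolding sum_distrib_right by (intro sum.cong refl) (simp only: mult_ac)
        finally show ?thesis .
      qed
      then show ?thesis unfolding X_def by simp
    qed
    also have "\<dots> = (\<Sum>A\<in>F. max_avg A f * (\<integral>\<^sup>+x\<in>A. g x * ennreal (w x) \<partial>lebesgue))"
      using setsA by (subst nn_integral_sum) (auto intro!: sum.cong nn_integral_cmult)
    finally show ?thesis by simp
  qed
  also have "\<dots> = (\<Sum>A\<in>F. ennreal \<gamma> * (max_avg A f * (\<integral>\<^sup>+x\<in>A. g x * ennreal (w x) \<partial>lebesgue)))"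
    by (simp add: sum_distrib_left)
  also have "\<dots> \<le> (\<Sum>A\<in>F. K\<^sup>2 * (\<integral>\<^sup>+x\<in>E A. P x * Q x \<partial>lebesgue))"
    unfolding P_def Q_def using F(2) E bdd by (intro sum_mono sparse_term_bound f g) auto
  also have "\<dots> = K\<^sup>2 * (\<Sum>A\<in>F. (\<integral>\<^sup>+x\<in>E A. P x * Q x \<partial>lebesgue))"
    by (simp add: sum_distrib_left)
  also have "\<dots> \<le> K\<^sup>2 * (\<integral>\<^sup>+x. P x * Q x \<partial>lebesgue)"
  proof (rule mult_left_mono)
    \<comment> \<open>Here sparseness is used: disjointness of the sets E A lets the local integrals
      add up to at most the global one.\<close>
    have disj: "disjoint_family_on E F" using E(4) F(2) by (rule disjoint_family_on_mono[rotated])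
    have "(\<Sum>A\<in>F. (\<integral>\<^sup>+x\<in>E A. P x * Q x \<partial>lebesgue)) = (\<integral>\<^sup>+x. (\<Sum>A\<in>F. P x * Q x * indicator (E A) x) \<partial>lebesgue)"
      using E(1) F(2) by (intro nn_integral_sum[symmetric] borel_measurable_times_ennreal borel_measurable_indicator) auto
    also have "\<dots> = (\<integral>\<^sup>+x. P x * Q x * indicator (\<Union>A\<in>F. E A) x \<partial>lebesgue)"
      unfolding indicator_UN_disjoint[OF F(1) disj] by (simp add: sum_distrib_left)
    also have "\<dots> \<le> (\<integral>\<^sup>+x. P x * Q x \<partial>lebesgue)"
      by (intro nn_integral_mono) (auto simp: indicator_def)
    finally show "(\<Sum>A\<in>F. (\<integral>\<^sup>+x\<in>E A. P x * Q x \<partial>lebesgue)) \<le> (\<integral>\<^sup>+x. P x * Q x \<partial>lebesgue)" .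
  qed simp
  finally have main: "ennreal \<gamma> * X \<le> K\<^sup>2 * (\<integral>\<^sup>+x. P x * Q x \<partial>lebesgue)" .
  have "(\<integral>\<^sup>+x. P x * Q x \<partial>lebesgue)\<^sup>2 \<le>
    (\<integral>\<^sup>+x. (P x)\<^sup>2 * ennreal (inverse (w x)) \<partial>lebesgue) * (\<integral>\<^sup>+x. (Q x)\<^sup>2 * ennreal (w x) \<partial>lebesgue)"
    by (rule integral_product_le) measurable
  also have "\<dots> \<le> (16 * (\<integral>\<^sup>+x. (majorant ?u x)\<^sup>2 * ennreal (w x) \<partial>lebesgue)) * (16 * X)"
    unfolding P_def Q_def X_def by (intro mult_mono max_fun_nu_L2 max_fun_mu_L2) auto
  also have "\<dots> \<le> (16 * (256 * U)) * (16 * X)"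
    unfolding U_def by (intro mult_right_mono mult_left_mono majorant_L2) auto
  also have "\<dots> = 65536 * U * X" by (simp add: mult_ac)
  finally have PQ: "(\<integral>\<^sup>+x. P x * Q x \<partial>lebesgue)\<^sup>2 \<le> 65536 * U * X" .
  have "(ennreal \<gamma>)\<^sup>2 * X * X = (ennreal \<gamma> * X)\<^sup>2" by (simp add: power2_eq_square mult_ac)
  also have "\<dots> \<le> (K\<^sup>2 * (\<integral>\<^sup>+x. P x * Q x \<partial>lebesgue))\<^sup>2"
    using main by (rule power_mono) simp
  also have "\<dots> = (K\<^sup>2)\<^sup>2 * (\<integral>\<^sup>+x. P x * Q x \<partial>lebesgue)\<^sup>2" by (rule power_mult_distrib)
  also have "\<dots> \<le> (K\<^sup>2)\<^sup>2 * (65536 * U * X)" using PQ by (rule mult_left_mono) simp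
  also have "\<dots> = ((K\<^sup>2)\<^sup>2 * 65536 * U) * X" by (simp only: mult_ac)
  finally have quad: "(ennreal \<gamma>)\<^sup>2 * X * X \<le> ((K\<^sup>2)\<^sup>2 * 65536 * U) * X" .
  have "(ennreal \<gamma>)\<^sup>2 * X \<le> (K\<^sup>2)\<^sup>2 * 65536 * U"
  proof (cases "X = 0")
    case False
    have "(ennreal \<gamma>)\<^sup>2 * X * X / X \<le> ((K\<^sup>2)\<^sup>2 * 65536 * U) * X / X"
      using quad by (rule divide_right_mono_ennreal)
    then show ?thesis using False X_finite by (simp add: ennreal_mult_divide_eq)
  qed simp
  then have "(ennreal (1 / \<gamma>))\<^sup>2 * ((ennreal \<gamma>)\<^sup>2 * X) \<le> (ennreal (1 / \<gamma>))\<^sup>2 * ((K\<^sup>2)\<^sup>2 * 65536 * U)"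
    by (rule mult_left_mono) simp
  also have "(ennreal (1 / \<gamma>))\<^sup>2 * ((ennreal \<gamma>)\<^sup>2 * X) = (ennreal (1 / \<gamma>) * ennreal \<gamma>)\<^sup>2 * X"
    by (simp only: power2_eq_square mult_ac)
  also have "ennreal (1 / \<gamma>) * ennreal \<gamma> = 1" using \<gamma> by (simp flip: ennreal_mult)
  also have "(ennreal (1 / \<gamma>))\<^sup>2 * ((K\<^sup>2)\<^sup>2 * 65536 * U) = (ennreal (1 / \<gamma>) * 256 * K\<^sup>2)\<^sup>2 * U"
    by (simp add: power2_eq_square mult_ac)
  also have "ennreal (1 / \<gamma>) * 256 = ennreal (256 / \<gamma>)"
    using \<gamma> by (simp flip: ennreal_mult ennreal_numeral)
  finally show ?thesis unfolding X_def U_def g_def by simp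
qed

text \<open>The constant for finite subfamilies does not depend on the subfamily, so monotone
  convergence along an enumeration transfers it to S.\<close>

lemma strong_sparse_bound:
  assumes f [measurable]: "f \<in> borel_measurable lebesgue" and \<gamma>: "0 < \<gamma>" and S: "gamma_sparse \<gamma> S"
    and fin: "(\<integral>\<^sup>+x. (ennreal \<bar>f x\<bar>)\<^sup>2 * ennreal (w x) \<partial>lebesgue) < \<infinity>"
  shows "(\<integral>\<^sup>+x. (strong_sparse_op S f x)\<^sup>2 * ennreal (w x) \<partial>lebesgue)
    \<le> (ennreal (256 / \<gamma>) * K\<^sup>2)\<^sup>2 * (\<integral>\<^sup>+x. (ennreal \<bar>f x\<bar>)\<^sup>2 * ennreal (w x) \<partial>lebesgue)"
proof (cases "S = {}")
  case True
  then show ?thesis by (simp add: strong_sparse_op_def)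
next
  case False
  then obtain e :: "nat \<Rightarrow> real set" where e: "S = range e"
    using gamma_sparse_countable[OF \<gamma> S] by (metis uncountable_def)
  define s where "s = (\<lambda>n x. \<Sum>A\<in>e ` {..n}. max_avg A f * indicator A x)"
  have "e n \<in> sets lebesgue" for n
  proof -
    have "bdd_interval (e n)" using S e by (auto simp: gamma_sparse_def)
    then show ?thesis using bdd_interval_endpoints interval_sets_lebesgue by metis
  qed
  then have [measurable]: "s n \<in> borel_measurable lebesgue" for n
    unfolding s_def by (intro borel_measurable_sum borel_measurable_times_ennreal borel_measurable_indicator) auto
  have inc: "incseq (\<lambda>n. s n x)" for x
    unfolding s_def incseq_def by (intro allI impI sum_mono2) auto
  have "(strong_sparse_op S f x)\<^sup>2 * ennreal (w x) = (SUP n. (s n x)\<^sup>2 * ennreal (w x))" for x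
  proof -
    have "strong_sparse_op S f x = (SUP n. s n x)"
      unfolding strong_sparse_op_def s_def by (rule infsum_range_eq_SUP[OF e])
    then show ?thesis by (simp add: SUP_power2_ennreal[OF inc] SUP_mult_right_ennreal)
  qed
  then have "(\<integral>\<^sup>+x. (strong_sparse_op S f x)\<^sup>2 * ennreal (w x) \<partial>lebesgue)
      = (\<integral>\<^sup>+x. (SUP n. (s n x)\<^sup>2 * ennreal (w x)) \<partial>lebesgue)" by simp
  also have "\<dots> = (SUP n. \<integral>\<^sup>+x. (s n x)\<^sup>2 * ennreal (w x) \<partial>lebesgue)"
  proof (rule nn_integral_monotone_convergence_SUP)
    show "incseq (\<lambda>n x. (s n x)\<^sup>2 * ennreal (w x))"
      using inc by (auto simp: incseq_def le_fun_def intro!: mult_right_mono power_mono)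
  qed measurable
  also have "\<dots> \<le> (ennreal (256 / \<gamma>) * K\<^sup>2)\<^sup>2 * (\<integral>\<^sup>+x. (ennreal \<bar>f x\<bar>)\<^sup>2 * ennreal (w x) \<partial>lebesgue)"
    unfolding s_def using e by (intro SUP_least finite_sparse_bound[OF f \<gamma> S _ _ fin]) auto
  finally show ?thesis .
qed

end

lemma a2_bound_if_A2_weight:
  assumes "A2_weight w"
  shows "a2_bound w (A2_const w)"
proof
  show "w \<in> borel_measurable lebesgue" "0 < w x" "A2_const w \<noteq> \<infinity>" for x
    using assms by (auto simp: A2_weight_def weight_def)
  fix a b :: real assume ab: "a < b"
  let ?W = "\<integral>\<^sup>+x\<in>{a<..<b}. ennreal (w x) \<partial>lebesgue" and ?V = "\<integral>\<^sup>+x\<in>{a<..<b}. ennreal (inverse (w x)) \<partial>lebesgue"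
  let ?L = "ennreal (b - a)"
  have "?W / emeasure lebesgue {a<..<b} * (?V / emeasure lebesgue {a<..<b}) \<le> A2_const w"
    unfolding A2_const_def using bdd_interval_greaterThanLessThan[OF ab] by (intro SUP_upper) simp
  then have "?W / ?L * (?V / ?L) * ?L\<^sup>2 \<le> A2_const w * ?L\<^sup>2"
    using ab by (intro mult_right_mono) auto
  also have "?W / ?L * (?V / ?L) * ?L\<^sup>2 = (?W / ?L * ?L) * (?V / ?L * ?L)"
    by (simp only: power2_eq_square mult_ac)
  also have "\<dots> = ?W * ?V"
  proof -
    have "x / ?L * ?L = x" for x
      using ab by (metis divide_ennreal_def ennreal_mult_divide_cancel_right ennreal_times_divide mult.commute diff_gt_0_iff_gt)
    then show ?thesis by simp
  qed
  finally show "?W * ?V \<le> A2_const w * ?L\<^sup>2" .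
qed

lemma strong_sparse_upper_bound:
  assumes "0 < \<gamma>" "gamma_sparse \<gamma> S" "A2_weight w"
  shows "L2_op_norm w (strong_sparse_op S) \<le> ennreal (256 / \<gamma>) * (A2_const w)\<^sup>2"
proof (rule L2_op_norm_le)
  fix f assume f: "f \<in> L2_space w"
  interpret a2_bound w "A2_const w" by (rule a2_bound_if_A2_weight[OF assms(3)])
  show "(\<integral>\<^sup>+x. (strong_sparse_op S f x)\<^sup>2 * ennreal (w x) \<partial>lebesgue)
    \<le> (ennreal (256 / \<gamma>) * (A2_const w)\<^sup>2)\<^sup>2 * (\<integral>\<^sup>+x. (ennreal \<bar>f x\<bar>)\<^sup>2 * ennreal (w x) \<partial>lebesgue)"
    using f by (intro strong_sparse_bound L2_space_finite assms) (auto simp: L2_space_def)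
qed

section \<open>The spiked power weight\<close>

lemma nn_integral_powr_from_0:
  assumes "0 < al" "0 < R"
  shows "(\<integral>\<^sup>+x\<in>{0<..<R}. ennreal (\<bar>x\<bar> powr (al - 1)) \<partial>lborel) = ennreal (R powr al / al)"
proof -
  have "((\<lambda>x. x powr (al - 1)) has_integral (R powr al / al)) {0..R}"
    using has_integral_powr_from_0[of "al - 1" R] assms by simp
  then have "(\<integral>\<^sup>+x\<in>{0..R}. ennreal (x powr (al - 1)) \<partial>lborel) = ennreal (R powr al / al)"
    by (intro nn_integral_has_integral_lebesgue') auto
  moreover have "AE x in lborel. x \<noteq> 0 \<and> x \<noteq> R"
    using AE_lborel_singleton[of 0] AE_lborel_singleton[of R] by eventually_elim simp
  then have "(\<integral>\<^sup>+x\<in>{0<..<R}. ennreal (\<bar>x\<bar> powr (al - 1)) \<partial>lborel) = (\<integral>\<^sup>+x\<in>{0..R}. ennreal (x powr (al - 1)) \<partial>lborel)"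
  proof (intro nn_integral_cong_AE)
    assume "AE x in lborel. x \<noteq> 0 \<and> x \<noteq> R"
    then show "AE x in lborel. ennreal (\<bar>x\<bar> powr (al - 1)) * indicator {0<..<R} x
        = ennreal (x powr (al - 1)) * indicator {0..R} x"
      by eventually_elim (auto simp: indicator_def)
  qed
  ultimately show ?thesis by simp
qed

lemma nn_integral_powr_right:
  fixes c :: real
  assumes "0 < al" "0 < R"
  shows "(\<integral>\<^sup>+x\<in>{c<..<c + R}. ennreal (\<bar>x - c\<bar> powr (al - 1)) \<partial>lebesgue) = ennreal (R powr al / al)"
  unfolding nn_integral_completion nn_integral_powr_from_0[OF assms, symmetric]
  by (subst nn_integral_real_affine[where c = 1 and t = c]) (auto simp: indicator_def intro!: nn_integral_cong)

lemma nn_integral_powr_left: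
  fixes c :: real
  assumes "0 < al" "0 < R"
  shows "(\<integral>\<^sup>+x\<in>{c - R<..<c}. ennreal (\<bar>x - c\<bar> powr (al - 1)) \<partial>lebesgue) = ennreal (R powr al / al)"
  unfolding nn_integral_completion nn_integral_powr_from_0[OF assms, symmetric]
  by (subst nn_integral_real_affine[where c = "-1" and t = c]) (auto simp: indicator_def intro!: nn_integral_cong)

lemma nn_integral_powr_ball:
  fixes c :: real
  assumes "0 < al" "0 < R"
  shows "(\<integral>\<^sup>+x\<in>{c - R<..<c + R}. ennreal (\<bar>x - c\<bar> powr (al - 1)) \<partial>lebesgue) = ennreal (2 * R powr al / al)"
proof -
  have "(\<integral>\<^sup>+x\<in>{c - R<..<c + R}. ennreal (\<bar>x - c\<bar> powr (al - 1)) \<partial>lebesgue) =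
    (\<integral>\<^sup>+x. ennreal (\<bar>x - c\<bar> powr (al - 1)) * indicator {c - R<..<c} x
       + ennreal (\<bar>x - c\<bar> powr (al - 1)) * indicator {c<..<c + R} x \<partial>lebesgue)"
    using assms(2) by (intro nn_integral_cong) (auto simp: indicator_def)
  also have "\<dots> = ennreal (R powr al / al) + ennreal (R powr al / al)"
    using nn_integral_powr_left[OF assms, of c] nn_integral_powr_right[OF assms, of c]
    unfolding nn_integral_completion by (subst nn_integral_add) auto
  also have "\<dots> = ennreal (2 * R powr al / al)"
    using assms by (simp flip: ennreal_plus)
  finally show ?thesis .
qed

lemma set_nn_integral_le_const:
  fixes a b :: real
  assumes "a \<le> b" "\<And>x. a < x \<Longrightarrow> x < b \<Longrightarrow> h x \<le> M"
  shows "(\<integral>\<^sup>+x\<in>{a<..<b}. h x \<partial>lebesgue) \<le> M * ennreal (b - a)"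
proof -
  have "(\<integral>\<^sup>+x\<in>{a<..<b}. h x \<partial>lebesgue) \<le> (\<integral>\<^sup>+x. M * indicator {a<..<b} x \<partial>lebesgue)"
    using assms(2) by (intro nn_integral_mono) (auto simp: indicator_def)
  also have "\<dots> = M * ennreal (b - a)"
    using assms(1) by (subst nn_integral_cmult_indicator) auto
  finally show ?thesis .
qed

text \<open>If I = (a, b) is far from c compared with its length, |x - c| varies on I by a factor of
  at most 3 and the product is at most 3 |I|^2. Otherwise I lies in the ball of radius R = 3 |I|
  about c; the singular integral is at most 2 R^al / al, the other at most R^(1 - al) |I|, and the
  product is 6 |I|^2 / al. The constant 36 leaves room for both.\<close>

lemma powr_A2_bound:
  fixes a b c :: real
  assumes al: "0 < al" "al \<le> 1" and ab: "a < b"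
  shows "(\<integral>\<^sup>+x\<in>{a<..<b}. ennreal (\<bar>x - c\<bar> powr (al - 1)) \<partial>lebesgue) *
      (\<integral>\<^sup>+x\<in>{a<..<b}. ennreal (\<bar>x - c\<bar> powr (1 - al)) \<partial>lebesgue) \<le> ennreal (36 / al) * (ennreal (b - a))\<^sup>2"
    (is "?V * ?W \<le> _")
proof (cases "2 * (b - a) \<le> \<bar>a - c\<bar>")
  case True
  define m where "m = \<bar>a - c\<bar> / 2"
  have m: "0 < m" using True ab unfolding m_def by simp
  have mx: "m \<le> \<bar>x - c\<bar>" "\<bar>x - c\<bar> \<le> 3 * m" if "a < x" "x < b" for x
    using that True by (auto simp: m_def abs_if split: if_splits)
  have "?V \<le> ennreal (m powr (al - 1)) * ennreal (b - a)"
    using ab m al mx by (intro set_nn_integral_le_const ennreal_leI powr_mono2') auto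
  moreover have "?W \<le> ennreal ((3 * m) powr (1 - al)) * ennreal (b - a)"
    using ab m al mx by (intro set_nn_integral_le_const ennreal_leI powr_mono2) auto
  ultimately have "?V * ?W \<le> (ennreal (m powr (al - 1)) * ennreal (b - a)) * (ennreal ((3 * m) powr (1 - al)) * ennreal (b - a))"
    by (intro mult_mono) auto
  also have "\<dots> = ennreal (m powr (al - 1) * (3 * m) powr (1 - al)) * (ennreal (b - a))\<^sup>2"
    by (simp add: ennreal_mult power2_eq_square mult_ac)
  also have "\<dots> \<le> ennreal (36 / al) * (ennreal (b - a))\<^sup>2"
  proof (intro mult_right_mono ennreal_leI)
    have "m powr (al - 1) * (3 * m) powr (1 - al) = 3 powr (1 - al) * (m powr (al - 1) * m powr (1 - al))"
      using m by (simp add: powr_mult)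
    also have "m powr (al - 1) * m powr (1 - al) = 1"
      using m by (simp flip: powr_add)
    also have "3 powr (1 - al) * 1 \<le> (3 :: real) powr 1 * 1"
      using al by (intro mult_right_mono powr_mono) auto
    also have "\<dots> \<le> 36 / al" using al by (simp add: field_simps)
    finally show "m powr (al - 1) * (3 * m) powr (1 - al) \<le> 36 / al" .
  qed simp
  finally show ?thesis .
next
  case False
  define R where "R = 3 * (b - a)"
  have R: "0 < R" using ab unfolding R_def by simp
  have near: "c - R < x \<and> x < c + R" if "a < x" "x < b" for x
    using that False by (auto simp: R_def abs_if split: if_splits)
  have "?V \<le> (\<integral>\<^sup>+x\<in>{c - R<..<c + R}. ennreal (\<bar>x - c\<bar> powr (al - 1)) \<partial>lebesgue)"
    using near by (intro nn_integral_mono) (auto simp: indicator_def)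
  then have V: "?V \<le> ennreal (2 * R powr al / al)"
    by (simp only: nn_integral_powr_ball[OF al(1) R])
  have W: "?W \<le> ennreal (R powr (1 - al)) * ennreal (b - a)"
    using ab al near by (intro set_nn_integral_le_const ennreal_leI powr_mono2) (auto simp: abs_le_iff less_imp_le, (smt (verit) near)+)
  have "?V * ?W \<le> ennreal (2 * R powr al / al) * (ennreal (R powr (1 - al)) * ennreal (b - a))"
    by (intro mult_mono V W) auto
  also have "\<dots> = ennreal (2 * R powr al / al * (R powr (1 - al) * (b - a)))"
    using al R ab by (simp flip: ennreal_mult)
  also have "2 * R powr al / al * (R powr (1 - al) * (b - a)) = 2 / al * (R powr al * R powr (1 - al)) * (b - a)"
    by simp
  also have "R powr al * R powr (1 - al) = 3 * (b - a)"
    using R by (simp add: R_def flip: powr_add)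
  also have "2 / al * (3 * (b - a)) * (b - a) = 6 / al * (b - a)\<^sup>2"
    by (simp add: power2_eq_square)
  also have "ennreal (6 / al * (b - a)\<^sup>2) \<le> ennreal (36 / al * (b - a)\<^sup>2)"
    using al by (intro ennreal_leI mult_right_mono divide_right_mono) auto
  also have "\<dots> = ennreal (36 / al) * (ennreal (b - a))\<^sup>2"
    using al ab by (subst ennreal_mult) (auto simp: ennreal_power)
  finally show ?thesis .
qed

section \<open>The spikes and their supports\<close>

definition spike_center :: "nat \<Rightarrow> real" where
  "spike_center j = (1 / 4) ^ j"

definition spike_region :: "nat \<Rightarrow> real set" where
  "spike_region j = {spike_center j / 2<..<3 * spike_center j / 2}"

text \<open>The factor \<open>al\<close> compensates the 1/al in the integral of |x - r|^(al - 1).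
  The square of r^(1 - al) cancels the square of the averages r^(al - 1) of the extremizer.\<close>

definition spike :: "real \<Rightarrow> nat \<Rightarrow> real \<Rightarrow> real" where
  "spike al j x = al * spike_center j powr (2 - 2 * al) * \<bar>x - spike_center j\<bar> powr (al - 1) *
     indicator (spike_region j) x"

text \<open>A spike has about the same mass as the power weight on its region, so at scales above
  its width the sum behaves like the power weight. Since \<open>0 powr a = 0\<close>, the spike vanishes at its
  own center, and the power weight has to be made positive at \<open>0\<close>.\<close>

definition spiked_weight :: "real \<Rightarrow> real \<Rightarrow> real" where
  "spiked_weight al x = (if x = 0 then 1 else \<bar>x\<bar> powr (1 - al)) + (\<Sum>j. spike al j x)"

lemma spike_center_pos [simp]: "0 < spike_center j"
  by (simp add: spike_center_def)

lemma spike_center_le: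
  assumes "i < j" shows "4 * spike_center j \<le> spike_center i"
proof -
  obtain k where k: "j = Suc (i + k)" using assms less_iff_Suc_add by auto
  have "(1 / 4 :: real) ^ k \<le> 1" by (intro power_le_one) auto
  then show ?thesis by (simp add: spike_center_def k power_add)
qed

text \<open>With r = \<open>spike_center j\<close>, the next smaller region ends at (3/2) (r/4) = 3
  r / 8 and the next larger one begins at 4 r / 2 = 2 r. The window (3 r / 8, 2 r) thus meets only
  the region of index j, and it leaves a margin around that region.\<close>

lemma not_in_other_spike_region:
  assumes "3 * spike_center j / 8 < x" "x < 2 * spike_center j" "i \<noteq> j"
  shows "x \<notin> spike_region i"
proof (cases "i < j")
  case True
  then show ?thesis using spike_center_le[of i j] assms by (auto simp: spike_region_def)
next
  case False
  then have "j < i" using assms(3) by simp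
  then show ?thesis using spike_center_le[of j i] assms by (auto simp: spike_region_def)
qed

lemma spike_region_subset: "x \<in> spike_region j \<Longrightarrow> 3 * spike_center j / 8 < x \<and> x < 2 * spike_center j"
  using spike_center_pos[of j] by (auto simp: spike_region_def)

lemma disjoint_spike_regions: "disjoint_family spike_region"
  unfolding disjoint_family_on_def using spike_region_subset not_in_other_spike_region by blast

lemma spike_nonneg: "0 \<le> al \<Longrightarrow> 0 \<le> spike al j x"
  by (simp add: spike_def)

lemma spike_region_measurable [measurable]: "spike_region j \<in> sets borel"
  by (simp add: spike_region_def)

lemma spike_measurable [measurable]: "spike al j \<in> borel_measurable borel"
  unfolding spike_def spike_region_def by measurable

lemma spike_outside: "x \<notin> spike_region j \<Longrightarrow> spike al j x = 0"
  by (simp add: spike_def)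

lemma suminf_spike:
  assumes "3 * spike_center j / 8 < x" "x < 2 * spike_center j"
  shows "(\<Sum>i. spike al i x) = spike al j x"
  by (subst suminf_finite[of "{j}"]) (auto intro!: spike_outside not_in_other_spike_region[OF assms])

lemma summable_spike: "summable (\<lambda>j. spike al j x)"
proof (cases "\<exists>j. x \<in> spike_region j")
  case True
  then obtain j where "x \<in> spike_region j" by blast
  then show ?thesis
    using spike_region_subset not_in_other_spike_region by (intro summable_finite[of "{j}"]) (blast intro: spike_outside)+
next
  case False
  then show ?thesis by (simp add: spike_outside)
qed

lemma spiked_weight_ge:
  assumes "0 < al"
  shows "(if x = 0 then 1 else \<bar>x\<bar> powr (1 - al)) \<le> spiked_weight al x"
  unfolding spiked_weight_def using suminf_nonneg[OF summable_spike spike_nonneg, of al x] assms by simp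

lemma spiked_weight_pos: "0 < al \<Longrightarrow> 0 < spiked_weight al x"
  using spiked_weight_ge[of al x] by (cases "x = 0") (auto intro: less_le_trans[rotated])

lemma spiked_weight_measurable [measurable]: "spiked_weight al \<in> borel_measurable borel"
  unfolding spiked_weight_def by measurable

lemma spiked_weight_ge_spike:
  assumes "0 < al"
  shows "spike al j x \<le> spiked_weight al x"
proof -
  have "spike al j x = sum (\<lambda>i. spike al i x) {j}" by simp
  also have "\<dots> \<le> (\<Sum>i. spike al i x)"
    using assms by (intro sum_le_suminf summable_spike) (auto simp: spike_nonneg)
  finally show ?thesis unfolding spiked_weight_def by (auto intro: order_trans)
qed

lemma spike_center_powr_mult:
  assumes "al \<le> 1"
  shows "spike_center j powr (2 - 2 * al) = (spike_center j powr (1 - al))\<^sup>2"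
  by (simp add: power2_eq_square flip: powr_add)

text \<open>With s = r^(1 - al) the mass is 2 s^2 (r/2)^al, which is at most 2 s r; on the region,
  of length r, the power weight is at least s / 2.\<close>

lemma spike_mass_le:
  assumes al: "0 < al" "al \<le> 1"
  shows "(\<integral>\<^sup>+x. ennreal (spike al j x) \<partial>lebesgue) \<le> 4 * (\<integral>\<^sup>+x\<in>spike_region j. ennreal (\<bar>x\<bar> powr (1 - al)) \<partial>lebesgue)"
proof -
  define r where "r = spike_center j"
  define s where "s = r powr (1 - al)"
  have r: "0 < r" by (simp add: r_def)
  have s: "0 < s" using r by (simp add: s_def)
  have region: "spike_region j = {r - r / 2<..<r + r / 2}" by (auto simp: spike_region_def r_def)
  have "ennreal (spike al j x) = ennreal (al * s\<^sup>2) *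
      (ennreal (\<bar>x - r\<bar> powr (al - 1)) * indicator {r - r / 2<..<r + r / 2} x)" for x
    using al spike_center_powr_mult[OF al(2), of j]
    by (simp add: spike_def region ennreal_mult indicator_def flip: r_def s_def)
  then have "(\<integral>\<^sup>+x. ennreal (spike al j x) \<partial>lebesgue) = ennreal (al * s\<^sup>2) *
      (\<integral>\<^sup>+x\<in>{r - r / 2<..<r + r / 2}. ennreal (\<bar>x - r\<bar> powr (al - 1)) \<partial>lebesgue)"
    unfolding nn_integral_completion by (simp add: nn_integral_cmult)
  also have "\<dots> = ennreal (al * s\<^sup>2) * ennreal (2 * (r / 2) powr al / al)"
    using r by (subst nn_integral_powr_ball[OF al(1)]) auto
  also have "\<dots> = ennreal (2 * s\<^sup>2 * (r / 2) powr al)"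
    using al by (simp flip: ennreal_mult)
  also have "\<dots> \<le> ennreal (4 * ((r / 2) powr (1 - al) * r))"
  proof (rule ennreal_leI)
    have "s * (r / 2) powr al \<le> s * r powr al"
      using r s al by (intro mult_left_mono powr_mono2) auto
    also have "\<dots> = r" using r by (simp add: s_def flip: powr_add)
    finally have 1: "s * (r / 2) powr al \<le> r" .
    have "(1 / 2) powr 1 \<le> (1 / 2 :: real) powr (1 - al)"
      using al by (intro powr_mono') auto
    then have "s * (1 / 2) \<le> s * (1 / 2) powr (1 - al)"
      using s by (intro mult_left_mono) auto
    also have "\<dots> = (r / 2) powr (1 - al)"
      using r powr_mult[of r "1 / 2" "1 - al"] by (simp add: s_def)
    finally have 2: "s \<le> 2 * (r / 2) powr (1 - al)" by simp
    have "2 * s\<^sup>2 * (r / 2) powr al = 2 * (s * (s * (r / 2) powr al))" by (simp add: power2_eq_square)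
    also have "\<dots> \<le> 2 * ((2 * (r / 2) powr (1 - al)) * r)"
      using 1 2 s r by (intro mult_left_mono mult_mono) auto
    finally show "2 * s\<^sup>2 * (r / 2) powr al \<le> 4 * ((r / 2) powr (1 - al) * r)" by simp
  qed
  also have "\<dots> = 4 * (ennreal r * ennreal ((r / 2) powr (1 - al)))"
    using r by (simp add: ennreal_mult mult_ac)
  also have "\<dots> \<le> 4 * (\<integral>\<^sup>+x\<in>spike_region j. ennreal (\<bar>x\<bar> powr (1 - al)) \<partial>lebesgue)"
  proof (rule mult_left_mono)
    have "ennreal ((r + r / 2) - (r - r / 2)) * ennreal ((r / 2) powr (1 - al))
      \<le> (\<integral>\<^sup>+x\<in>{r - r / 2<..<r + r / 2}. ennreal (\<bar>x\<bar> powr (1 - al)) \<partial>lebesgue)"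
      using r al by (intro length_mult_le_integral ennreal_leI powr_mono2) auto
    then show "ennreal r * ennreal ((r / 2) powr (1 - al)) \<le> (\<integral>\<^sup>+x\<in>spike_region j. ennreal (\<bar>x\<bar> powr (1 - al)) \<partial>lebesgue)"
      unfolding region by simp
  qed simp
  finally show ?thesis .
qed

section \<open>The A2 constant of the spiked weight\<close>

lemma AE_lebesgue_neq: "AE x in lebesgue. x \<noteq> (c :: real)"
  using AE_lborel_singleton[of c] by (rule AE_completion)

text \<open>Only one spike is visible here, and the weight is comparable to s plus the spike al s^2
  |x - r|^(al - 1). Each summand of the weight is paired with the bound for 1/w that it suggests:
  the constant part with \<open>V1\<close>, the spike with \<open>V2\<close>. The first product is
  of order |I|^2, the second reduces to the A2 bound for a power centred at r, and 16/3 + (16/3) 36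
  <= 400.\<close>

lemma spiked_weight_A2_near_spike:
  assumes al: "0 < al" "al \<le> 1" and ab: "a < b"
    and j: "3 * spike_center j / 8 \<le> a" "b \<le> 2 * spike_center j"
  shows "(\<integral>\<^sup>+x\<in>{a<..<b}. ennreal (spiked_weight al x) \<partial>lebesgue) *
      (\<integral>\<^sup>+x\<in>{a<..<b}. ennreal (inverse (spiked_weight al x)) \<partial>lebesgue) \<le> ennreal (400 / al) * (ennreal (b - a))\<^sup>2"
    (is "?W * ?V \<le> _")
proof -
  define r where "r = spike_center j"
  define s where "s = r powr (1 - al)"
  have r: "0 < r" by (simp add: r_def)
  have s: "0 < s" using r by (simp add: s_def)
  let ?L = "ennreal (b - a)"
  let ?v = "\<integral>\<^sup>+x\<in>{a<..<b}. ennreal (\<bar>x - r\<bar> powr (al - 1)) \<partial>lebesgue"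
  let ?p = "\<integral>\<^sup>+x\<in>{a<..<b}. ennreal (\<bar>x - r\<bar> powr (1 - al)) \<partial>lebesgue"
  have in_range: "3 * r / 8 < x" "x < 2 * r" "0 < x" if "a < x" "x < b" for x
    using that j r by (auto simp: r_def)
  have weq: "spiked_weight al x = x powr (1 - al) + spike al j x" if "a < x" "x < b" for x
    using in_range[OF that] suminf_spike[of j x al] unfolding spiked_weight_def r_def by simp
  have spike_le: "spike al j x \<le> al * s\<^sup>2 * \<bar>x - r\<bar> powr (al - 1)" for x
    using al spike_center_powr_mult[OF al(2), of j] by (auto simp: spike_def indicator_def simp flip: r_def s_def)
  have up: "x powr (1 - al) \<le> 2 * s" if "a < x" "x < b" for x
  proof -
    have "x powr (1 - al) \<le> (2 * r) powr (1 - al)"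
      using in_range[OF that] al by (intro powr_mono2) auto
    also have "\<dots> = 2 powr (1 - al) * s" using r by (simp add: powr_mult s_def)
    also have "\<dots> \<le> 2 powr 1 * s" using al s by (intro mult_right_mono powr_mono) auto
    finally show ?thesis by simp
  qed
  have low: "3 / 8 * s \<le> spiked_weight al x" if "a < x" "x < b" for x
  proof -
    have "3 / 8 * s = (3 / 8) powr 1 * s" by simp
    also have "\<dots> \<le> (3 / 8) powr (1 - al) * s" using al s by (intro mult_right_mono powr_mono') auto
    also have "\<dots> = (3 * r / 8) powr (1 - al)" using r powr_mult[of "3 / 8" r "1 - al"] by (simp add: s_def)
    also have "\<dots> \<le> x powr (1 - al)" using in_range[OF that] al r by (intro powr_mono2) auto
    also have "\<dots> \<le> spiked_weight al x"
      using spiked_weight_ge[OF al(1), of x] in_range[OF that] by simp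
    finally show ?thesis .
  qed
  have W: "?W \<le> ennreal (2 * s) * ?L + ennreal (al * s\<^sup>2) * ?v"
  proof -
    have "?W \<le> (\<integral>\<^sup>+x. ennreal (2 * s) * indicator {a<..<b} x
        + ennreal (al * s\<^sup>2) * (ennreal (\<bar>x - r\<bar> powr (al - 1)) * indicator {a<..<b} x) \<partial>lebesgue)"
    proof (rule nn_integral_mono)
      fix x
      show "ennreal (spiked_weight al x) * indicator {a<..<b} x \<le> ennreal (2 * s) * indicator {a<..<b} x
        + ennreal (al * s\<^sup>2) * (ennreal (\<bar>x - r\<bar> powr (al - 1)) * indicator {a<..<b} x)"
      proof (cases "x \<in> {a<..<b}")
        case True
        then have "spiked_weight al x \<le> 2 * s + al * s\<^sup>2 * \<bar>x - r\<bar> powr (al - 1)"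
          using weq[of x] up[of x] spike_le[of x] by simp
        then have "ennreal (spiked_weight al x) \<le> ennreal (2 * s) + ennreal (al * s\<^sup>2) * ennreal (\<bar>x - r\<bar> powr (al - 1))"
          using s al by (simp flip: ennreal_mult ennreal_plus)
        then show ?thesis using True by simp
      qed simp
    qed
    also have "\<dots> = ennreal (2 * s) * ?L + ennreal (al * s\<^sup>2) * ?v"
      using ab unfolding nn_integral_completion by (simp add: nn_integral_add nn_integral_cmult)
    finally show ?thesis .
  qed
  have V1: "?V \<le> ennreal (8 / (3 * s)) * ?L"
  proof (intro set_nn_integral_le_const ennreal_leI)
    fix x assume x: "a < x" "x < b"
    have "inverse (spiked_weight al x) \<le> inverse (3 / 8 * s)"
      using low[OF x] s by (intro le_imp_inverse_le) auto
    then show "inverse (spiked_weight al x) \<le> 8 / (3 * s)" by (simp add: field_simps)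
  qed (use ab in simp)
  have V2: "?V \<le> ennreal (16 / (3 * al * s\<^sup>2)) * ?p"
  proof -
    \<comment> \<open>At x = r the right side is 0, since \<open>0 powr e = 0\<close>; the point has
      to be excluded.\<close>
    have pt: "inverse (spiked_weight al x) \<le> 16 / (3 * al * s\<^sup>2) * \<bar>x - r\<bar> powr (1 - al)"
      if x: "a < x" "x < b" "x \<noteq> r" for x
    proof (cases "x \<in> spike_region j")
      case True
      have B: "spike al j x = al * s\<^sup>2 * \<bar>x - r\<bar> powr (al - 1)"
        using True spike_center_powr_mult[OF al(2), of j] by (simp add: spike_def flip: r_def s_def)
      have "inverse (spiked_weight al x) \<le> inverse (spike al j x)"
        using spiked_weight_ge_spike[OF al(1), of j x] x(3) al s unfolding B by (intro le_imp_inverse_le) auto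
      also have "\<dots> = 1 / (al * s\<^sup>2) * \<bar>x - r\<bar> powr (1 - al)"
        unfolding B using powr_minus[of "\<bar>x - r\<bar>" "al - 1"] by (simp add: field_simps)
      also have "\<dots> \<le> 16 / (3 * al * s\<^sup>2) * \<bar>x - r\<bar> powr (1 - al)"
        using al s by (intro mult_right_mono) (auto simp: field_simps)
      finally show ?thesis .
    next
      case False
      \<comment> \<open>Outside the region the spike is absent, but there |x - r|^(1 - al) is at
        least s / 2, so the lower bound 3 s / 8 from the power part is enough.\<close>
      then have far: "r / 2 \<le> \<bar>x - r\<bar>" by (auto simp: spike_region_def r_def abs_if)
      have "s / 2 = (1 / 2) powr 1 * s" by simp
      also have "\<dots> \<le> (1 / 2) powr (1 - al) * s" using al s by (intro mult_right_mono powr_mono') auto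
      also have "\<dots> = (r / 2) powr (1 - al)" using r powr_mult[of "1 / 2" r "1 - al"] by (simp add: s_def)
      also have "\<dots> \<le> \<bar>x - r\<bar> powr (1 - al)" using far r al by (intro powr_mono2) auto
      finally have half: "s / 2 \<le> \<bar>x - r\<bar> powr (1 - al)" .
      have "inverse (spiked_weight al x) \<le> inverse (3 / 8 * s)"
        using low[OF x(1,2)] s by (intro le_imp_inverse_le) auto
      also have "\<dots> = 16 / (3 * s\<^sup>2) * (s / 2)" using s by (simp add: field_simps power2_eq_square)
      also have "\<dots> \<le> 16 / (3 * al * s\<^sup>2) * \<bar>x - r\<bar> powr (1 - al)"
        using al s half by (intro mult_mono frac_le) (auto simp: field_simps)
      finally show ?thesis .
    qed
    have "?V \<le> (\<integral>\<^sup>+x. ennreal (16 / (3 * al * s\<^sup>2)) * (ennreal (\<bar>x - r\<bar> powr (1 - al)) * indicator {a<..<b} x) \<partial>lebesgue)"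
    proof (rule nn_integral_mono_AE)
      show "AE x in lebesgue. ennreal (inverse (spiked_weight al x)) * indicator {a<..<b} x
         \<le> ennreal (16 / (3 * al * s\<^sup>2)) * (ennreal (\<bar>x - r\<bar> powr (1 - al)) * indicator {a<..<b} x)"
        using AE_lebesgue_neq[of r]
      proof eventually_elim
        case (elim x)
        show ?case
        proof (cases "x \<in> {a<..<b}")
          case True
          then have "ennreal (inverse (spiked_weight al x)) \<le> ennreal (16 / (3 * al * s\<^sup>2) * \<bar>x - r\<bar> powr (1 - al))"
            using pt[of x] elim by (intro ennreal_leI) auto
          also have "\<dots> = ennreal (16 / (3 * al * s\<^sup>2)) * ennreal (\<bar>x - r\<bar> powr (1 - al))"
            using al by (intro ennreal_mult) auto
          finally show ?thesis using True by simp
        qed simp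
      qed
    qed
    also have "\<dots> = ennreal (16 / (3 * al * s\<^sup>2)) * ?p"
      unfolding nn_integral_completion by (rule nn_integral_cmult) measurable
    finally show ?thesis .
  qed
  have "?W * ?V \<le> (ennreal (2 * s) * ?L) * ?V + (ennreal (al * s\<^sup>2) * ?v) * ?V"
    using mult_right_mono[OF W, of ?V] by (simp only: distrib_right zero_le)
  also have "\<dots> \<le> (ennreal (2 * s) * ?L) * (ennreal (8 / (3 * s)) * ?L) +
      (ennreal (al * s\<^sup>2) * ?v) * (ennreal (16 / (3 * al * s\<^sup>2)) * ?p)"
    by (intro add_mono mult_left_mono V1 V2) auto
  also have "\<dots> = (ennreal (2 * s) * ennreal (8 / (3 * s))) * ?L\<^sup>2 +
     (ennreal (al * s\<^sup>2) * ennreal (16 / (3 * al * s\<^sup>2))) * (?v * ?p)"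
    by (simp only: power2_eq_square mult_ac)
  also have "ennreal (2 * s) * ennreal (8 / (3 * s)) = ennreal (16 / 3)"
    using s by (simp flip: ennreal_mult)
  also have "ennreal (al * s\<^sup>2) * ennreal (16 / (3 * al * s\<^sup>2)) = ennreal (16 / 3)"
    using s al by (simp flip: ennreal_mult)
  also have "ennreal (16 / 3) * ?L\<^sup>2 + ennreal (16 / 3) * (?v * ?p) \<le>
    ennreal (16 / 3) * ?L\<^sup>2 + ennreal (16 / 3) * (ennreal (36 / al) * ?L\<^sup>2)"
    by (intro add_mono mult_left_mono powr_A2_bound al ab) auto
  also have "\<dots> = (ennreal (16 / 3) + ennreal (16 / 3) * ennreal (36 / al)) * ?L\<^sup>2"
    by (simp only: distrib_right mult.assoc)
  also have "ennreal (16 / 3) + ennreal (16 / 3) * ennreal (36 / al) = ennreal (16 / 3 + 16 / 3 * (36 / al))"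
    using al by (simp flip: ennreal_mult ennreal_plus)
  also have "ennreal (16 / 3 + 16 / 3 * (36 / al)) * ?L\<^sup>2 \<le> ennreal (400 / al) * ?L\<^sup>2"
    using al by (intro mult_right_mono ennreal_leI) (auto simp: field_simps)
  finally show ?thesis .
qed

text \<open>An interval that meets a spike region and also leaves the window around it is so long
  that its 17-fold dilation I' contains the region. On I' the spikes may be replaced by power weight
  of at most 4 times its mass, by disjointness of the regions, so the whole weight costs 5 times the
  power weight. The constant is 52020 = 5 * 36 * 17^2, the square from the dilated length.\<close>

lemma spiked_weight_A2_far:
  assumes al: "0 < al" "al \<le> 1" and ab: "a < b"
    and far: "\<And>j. a < 3 * spike_center j / 8 \<or> 2 * spike_center j < b"
  shows "(\<integral>\<^sup>+x\<in>{a<..<b}. ennreal (spiked_weight al x) \<partial>lebesgue) *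
      (\<integral>\<^sup>+x\<in>{a<..<b}. ennreal (inverse (spiked_weight al x)) \<partial>lebesgue) \<le> ennreal (52020 / al) * (ennreal (b - a))\<^sup>2"
    (is "?W * ?V \<le> _")
proof -
  define a' where "a' = a - 8 * (b - a)"
  define b' where "b' = b + 8 * (b - a)"
  let ?I = "{a'<..<b'}"
  have ab': "a' < b'" "b' - a' = 17 * (b - a)" "a' < a" "b < b'" using ab by (auto simp: a'_def b'_def)
  let ?p = "\<lambda>x::real. ennreal (\<bar>x\<bar> powr (1 - al))"
  have five: "x + 4 * x = 5 * x" for x :: ennreal
    using distrib_right[of 1 4 x] by simp
  have sq: "(17 * b - 17 * a)\<^sup>2 = 289 * (b - a)\<^sup>2"
    by (simp add: power2_eq_square algebra_simps)
  have piece: "(\<integral>\<^sup>+x\<in>{a<..<b}. ennreal (spike al j x) \<partial>lebesgue)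
      \<le> 4 * (\<integral>\<^sup>+x. ?p x * indicator ?I x * indicator (spike_region j) x \<partial>lebesgue)" for j
  proof (cases "{a<..<b} \<inter> spike_region j = {}")
    case True
    then have "x \<in> {a<..<b} \<Longrightarrow> x \<notin> spike_region j" for x by blast
    then have zero: "ennreal (spike al j x) * indicator {a<..<b} x = 0" for x
      by (cases "x \<in> {a<..<b}") (simp_all add: spike_outside)
    show ?thesis unfolding zero by simp
  next
    case False
    then obtain x where "a < x" "x < b" "x \<in> spike_region j" by auto
    then have "spike_center j / 2 < x" "x < 3 * spike_center j / 2" by (auto simp: spike_region_def)
    \<comment> \<open>From a point of the region to the outside of the window the distance exceeds r
      / 8 on the left and r / 2 on the right. Hence 8 (b - a) > r, the length of the region.\<close>
    then have sub: "spike_region j \<subseteq> ?I"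
      using far[of j] \<open>a < x\<close> \<open>x < b\<close> unfolding spike_region_def a'_def b'_def
      by (auto intro: less_imp_le)
    have "(\<integral>\<^sup>+x\<in>{a<..<b}. ennreal (spike al j x) \<partial>lebesgue) \<le> (\<integral>\<^sup>+x. ennreal (spike al j x) \<partial>lebesgue)"
      by (intro nn_integral_mono) (auto simp: indicator_def)
    also have "\<dots> \<le> 4 * (\<integral>\<^sup>+x\<in>spike_region j. ?p x \<partial>lebesgue)" by (rule spike_mass_le[OF al])
    also have "(\<integral>\<^sup>+x\<in>spike_region j. ?p x \<partial>lebesgue) = (\<integral>\<^sup>+x. ?p x * indicator ?I x * indicator (spike_region j) x \<partial>lebesgue)"
      using sub by (intro nn_integral_cong) (auto simp: indicator_def)
    finally show ?thesis .
  qed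
  have "?W \<le> (\<integral>\<^sup>+x. ?p x * indicator ?I x + (\<Sum>j. ennreal (spike al j x) * indicator {a<..<b} x) \<partial>lebesgue)"
  proof (rule nn_integral_mono_AE)
    show "AE x in lebesgue. ennreal (spiked_weight al x) * indicator {a<..<b} x
      \<le> ?p x * indicator ?I x + (\<Sum>j. ennreal (spike al j x) * indicator {a<..<b} x)"
      using AE_lebesgue_neq[of 0]
    proof eventually_elim
      case (elim x)
      show ?case
      proof (cases "x \<in> {a<..<b}")
        case True
        have "ennreal (spiked_weight al x) = ?p x + (\<Sum>j. ennreal (spike al j x))"
          using elim al suminf_nonneg[OF summable_spike spike_nonneg, of al x]
          by (simp add: spiked_weight_def ennreal_plus suminf_ennreal2[OF spike_nonneg summable_spike])
        then show ?thesis using True ab' by simp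
      qed simp
    qed
  qed
  also have "\<dots> = (\<integral>\<^sup>+x\<in>?I. ?p x \<partial>lebesgue) + (\<integral>\<^sup>+x. (\<Sum>j. ennreal (spike al j x) * indicator {a<..<b} x) \<partial>lebesgue)"
    unfolding nn_integral_completion by (rule nn_integral_add) measurable
  also have "(\<integral>\<^sup>+x. (\<Sum>j. ennreal (spike al j x) * indicator {a<..<b} x) \<partial>lebesgue)
      = (\<Sum>j. \<integral>\<^sup>+x\<in>{a<..<b}. ennreal (spike al j x) \<partial>lebesgue)"
    unfolding nn_integral_completion by (rule nn_integral_suminf) measurable
  also have "(\<integral>\<^sup>+x\<in>?I. ?p x \<partial>lebesgue) + \<dots> \<le> (\<integral>\<^sup>+x\<in>?I. ?p x \<partial>lebesgue) + (\<Sum>j. 4 * (\<integral>\<^sup>+x. ?p x * indicator ?I x * indicator (spike_region j) x \<partial>lebesgue))"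
    by (intro add_left_mono suminf_le piece summableI)
  also have "(\<Sum>j. 4 * (\<integral>\<^sup>+x. ?p x * indicator ?I x * indicator (spike_region j) x \<partial>lebesgue)) =
      4 * (\<Sum>j. \<integral>\<^sup>+x. ?p x * indicator ?I x * indicator (spike_region j) x \<partial>lebesgue)"
    by (rule ennreal_suminf_cmult)
  also have "(\<Sum>j. \<integral>\<^sup>+x. ?p x * indicator ?I x * indicator (spike_region j) x \<partial>lebesgue) =
      (\<integral>\<^sup>+x. (\<Sum>j. ?p x * indicator ?I x * indicator (spike_region j) x) \<partial>lebesgue)"
    unfolding nn_integral_completion by (rule nn_integral_suminf[symmetric]) measurable
  also have "(\<integral>\<^sup>+x. (\<Sum>j. ?p x * indicator ?I x * indicator (spike_region j) x) \<partial>lebesgue)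
      = (\<integral>\<^sup>+x. ?p x * indicator ?I x * indicator (\<Union>j. spike_region j) x \<partial>lebesgue)"
    by (simp add: ennreal_suminf_cmult suminf_indicator[OF disjoint_spike_regions])
  also have "(\<integral>\<^sup>+x\<in>?I. ?p x \<partial>lebesgue) + 4 * \<dots> \<le> (\<integral>\<^sup>+x\<in>?I. ?p x \<partial>lebesgue) + 4 * (\<integral>\<^sup>+x\<in>?I. ?p x \<partial>lebesgue)"
    by (intro add_left_mono mult_left_mono nn_integral_mono) (auto simp: indicator_def)
  also have "\<dots> = 5 * (\<integral>\<^sup>+x\<in>?I. ?p x \<partial>lebesgue)"
    by (rule five)
  finally have W: "?W \<le> 5 * (\<integral>\<^sup>+x\<in>?I. ?p x \<partial>lebesgue)" .
  have V: "?V \<le> (\<integral>\<^sup>+x\<in>?I. ennreal (\<bar>x\<bar> powr (al - 1)) \<partial>lebesgue)"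
  proof (rule nn_integral_mono_AE)
    show "AE x in lebesgue. ennreal (inverse (spiked_weight al x)) * indicator {a<..<b} x
      \<le> ennreal (\<bar>x\<bar> powr (al - 1)) * indicator ?I x"
      using AE_lebesgue_neq[of 0]
    proof eventually_elim
      case (elim x)
      show ?case
      proof (cases "x \<in> {a<..<b}")
        case True
        have "inverse (spiked_weight al x) \<le> inverse (\<bar>x\<bar> powr (1 - al))"
          using elim spiked_weight_ge[OF al(1), of x] by (intro le_imp_inverse_le) auto
        also have "\<dots> = \<bar>x\<bar> powr (al - 1)" using powr_minus[of "\<bar>x\<bar>" "1 - al"] by simp
        finally show ?thesis using True ab' by (simp add: ennreal_leI)
      qed simp
    qed
  qed
  have "?W * ?V \<le> (5 * (\<integral>\<^sup>+x\<in>?I. ?p x \<partial>lebesgue)) * (\<integral>\<^sup>+x\<in>?I. ennreal (\<bar>x\<bar> powr (al - 1)) \<partial>lebesgue)"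
    by (intro mult_mono W V) auto
  also have "\<dots> = 5 * ((\<integral>\<^sup>+x\<in>?I. ennreal (\<bar>x - 0\<bar> powr (al - 1)) \<partial>lebesgue) * (\<integral>\<^sup>+x\<in>?I. ennreal (\<bar>x - 0\<bar> powr (1 - al)) \<partial>lebesgue))"
    by (simp add: mult_ac)
  also have "\<dots> \<le> 5 * (ennreal (36 / al) * (ennreal (b' - a'))\<^sup>2)"
    by (intro mult_left_mono powr_A2_bound al ab') auto
  also have "\<dots> = ennreal (52020 / al) * (ennreal (b - a))\<^sup>2"
    using al ab unfolding ab'(2) ennreal_power[of "17 * (b - a)" 2, simplified]
    by (simp add: ennreal_power sq flip: ennreal_mult ennreal_numeral)
  finally show ?thesis .
qed

lemma A2_const_le:
  assumes "\<And>a b. a < b \<Longrightarrow> (\<integral>\<^sup>+x\<in>{a<..<b}. ennreal (w x) \<partial>lebesgue) *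
      (\<integral>\<^sup>+x\<in>{a<..<b}. ennreal (inverse (w x)) \<partial>lebesgue) \<le> K * (ennreal (b - a))\<^sup>2"
  shows "A2_const w \<le> K"
  unfolding A2_const_def
proof (rule SUP_least, clarify)
  fix I assume I: "bdd_interval I"
  obtain a b where ab: "a < b" "{a<..<b} \<subseteq> I" "I \<subseteq> {a..b}"
    using bdd_interval_endpoints[OF I] by metis
  let ?L = "ennreal (b - a)"
  let ?W = "\<integral>\<^sup>+x\<in>I. ennreal (w x) \<partial>lebesgue" and ?V = "\<integral>\<^sup>+x\<in>I. ennreal (inverse (w x)) \<partial>lebesgue"
  have "?W / ?L * (?V / ?L) = ?W * ?V / ?L / ?L"
    unfolding divide_ennreal_def by (simp only: mult_ac)
  also have "\<dots> \<le> K * ?L\<^sup>2 / ?L / ?L"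
    using assms[OF ab(1)] unfolding set_nn_integral_interval_eq[OF ab(2,3)]
    by (intro divide_right_mono_ennreal)
  also have "\<dots> = K * ?L * ?L / ?L / ?L" by (simp add: power2_eq_square mult_ac)
  also have "\<dots> = K" using ab(1) by (simp add: ennreal_mult_divide_cancel_right)
  finally show "?W / emeasure lebesgue I * (?V / emeasure lebesgue I) \<le> K"
    unfolding emeasure_interval_eq[OF ab] .
qed

lemma A2_const_spiked_weight_le:
  assumes al: "0 < al" "al \<le> 1"
  shows "A2_const (spiked_weight al) \<le> ennreal (52020 / al)"
proof (rule A2_const_le)
  fix a b :: real assume ab: "a < b"
  show "(\<integral>\<^sup>+x\<in>{a<..<b}. ennreal (spiked_weight al x) \<partial>lebesgue) *
      (\<integral>\<^sup>+x\<in>{a<..<b}. ennreal (inverse (spiked_weight al x)) \<partial>lebesgue) \<le> ennreal (52020 / al) * (ennreal (b - a))\<^sup>2"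
  proof (cases "\<exists>j. 3 * spike_center j / 8 \<le> a \<and> b \<le> 2 * spike_center j")
    case True
    then obtain j where "3 * spike_center j / 8 \<le> a" "b \<le> 2 * spike_center j" by blast
    note spiked_weight_A2_near_spike[OF al ab this]
    also have "ennreal (400 / al) * (ennreal (b - a))\<^sup>2 \<le> ennreal (52020 / al) * (ennreal (b - a))\<^sup>2"
      using al by (intro mult_right_mono ennreal_leI divide_right_mono) auto
    finally show ?thesis .
  next
    case False
    then show ?thesis using spiked_weight_A2_far[OF al ab] by (meson not_less)
  qed
qed

lemma A2_weight_spiked_weight:
  assumes "0 < al" "al \<le> 1"
  shows "A2_weight (spiked_weight al)"
proof -
  have "spiked_weight al \<in> borel_measurable lebesgue"
    by (intro measurable_completion) simp
  then show ?thesis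
    using A2_const_spiked_weight_le[OF assms] spiked_weight_pos[OF assms(1)]
    by (auto simp: A2_weight_def weight_def intro: le_less_trans)
qed

section \<open>Sharpness\<close>

definition nested_interval :: "nat \<times> nat \<Rightarrow> real set" where
  "nested_interval p = {spike_center (fst p)<..<spike_center (fst p) + spike_center (fst p) / 2 ^ Suc (snd p)}"

text \<open>The right half of \<open>nested_interval p\<close>, up to a point. It serves twice: as
  the sparseness witness with constant 1/2, and as the set over which exactly the k + 1 intervals
  (j, 0), ..., (j, k) overlap.\<close>

definition shell :: "nat \<times> nat \<Rightarrow> real set" where
  "shell p = {spike_center (fst p) + spike_center (fst p) / 2 ^ Suc (Suc (snd p))<..<
     spike_center (fst p) + spike_center (fst p) / 2 ^ Suc (snd p)}"

lemma spike_center_neq_0 [simp]: "spike_center j \<noteq> 0"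
  using spike_center_pos[of j] by linarith

lemma spike_center_nonneg [simp]: "0 \<le> spike_center j"
  using spike_center_pos[of j] by linarith

lemma halving_mono:
  assumes "i \<le> k"
  shows "spike_center j / 2 ^ Suc k \<le> spike_center j / 2 ^ Suc i"
  using assms by (intro divide_left_mono power_increasing) (auto simp: less_imp_le)

lemma nested_interval_subset_spike_region: "nested_interval p \<subseteq> spike_region (fst p)"
proof
  fix x assume "x \<in> nested_interval p"
  moreover have "spike_center (fst p) / 2 ^ Suc (snd p) \<le> spike_center (fst p) / 2 ^ Suc 0"
    by (rule halving_mono) simp
  ultimately show "x \<in> spike_region (fst p)"
    using spike_center_pos[of "fst p"] by (simp add: nested_interval_def spike_region_def)
qed

lemma shell_subset: "shell p \<subseteq> nested_interval p"
proof
  fix x assume "x \<in> shell p"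
  moreover have "0 < spike_center (fst p) / 2 ^ Suc (Suc (snd p))" by simp
  ultimately show "x \<in> nested_interval p"
    unfolding nested_interval_def shell_def greaterThanLessThan_iff by (intro conjI; linarith)
qed

lemma shell_subset_nested_interval:
  assumes "i \<le> k" shows "shell (j, k) \<subseteq> nested_interval (j, i)"
proof -
  have "shell (j, k) \<subseteq> nested_interval (j, k)" by (rule shell_subset)
  also have "\<dots> \<subseteq> nested_interval (j, i)"
    using halving_mono[OF assms, of j] by (auto simp: nested_interval_def simp del: power_Suc)
  finally show ?thesis .
qed

lemma disjoint_shells: "disjoint_family shell"
  unfolding disjoint_family_on_def
proof (intro ballI impI)
  have *: "shell (j, k) \<inter> shell (j, l) = {}" if "k < l" for j k l
  proof -
    have "spike_center j / 2 ^ Suc l \<le> spike_center j / 2 ^ Suc (Suc k)"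
      using that by (intro halving_mono) simp
    then show ?thesis by (auto simp: shell_def simp del: power_Suc)
  qed
  fix p q :: "nat \<times> nat" assume "p \<noteq> q"
  obtain j k i l where pq: "p = (j, k)" "q = (i, l)" by (cases p, cases q) auto
  show "shell p \<inter> shell q = {}"
  proof (cases "i = j")
    case True
    then have "k < l \<or> l < k" using \<open>p \<noteq> q\<close> pq by auto
    then show ?thesis using *[of k l j] *[of l k j] True pq by auto
  next
    case False
    then have "spike_region j \<inter> spike_region i = {}"
      using disjoint_spike_regions by (auto simp: disjoint_family_on_def)
    moreover have "shell p \<subseteq> spike_region j" "shell q \<subseteq> spike_region i"
      using shell_subset nested_interval_subset_spike_region pq by fastforce+
    ultimately show ?thesis by blast
  qed
qed

lemma emeasure_nested_interval: "emeasure lebesgue (nested_interval p) = ennreal (spike_center (fst p) / 2 ^ Suc (snd p))"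
  by (simp add: nested_interval_def)

lemma emeasure_shell:
  "emeasure lebesgue (shell p) = ennreal (spike_center (fst p) / 2 ^ Suc (Suc (snd p)))"
  by (simp add: shell_def field_simps)

text \<open>The location of an interval determines j and its length determines k. Injectivity allows
  passing between the index pairs and the family as a set of sets.\<close>

lemma inj_nested_interval: "inj nested_interval"
proof (rule injI)
  fix p q assume eq: "nested_interval p = nested_interval q"
  have "emeasure lebesgue (shell p) \<noteq> 0" unfolding emeasure_shell by simp
  then have ne: "shell p \<noteq> {}" by force
  obtain x where x: "x \<in> shell p" using ne by blast
  have "x \<in> spike_region (fst p)" "x \<in> spike_region (fst q)"
    using x shell_subset[of p] eq nested_interval_subset_spike_region by blast+
  then have fst: "fst p = fst q"
    using disjoint_spike_regions by (auto simp: disjoint_family_on_def)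
  have "ennreal (spike_center (fst p) / 2 ^ Suc (snd p)) = ennreal (spike_center (fst q) / 2 ^ Suc (snd q))"
    using eq emeasure_nested_interval by metis
  then have "spike_center (fst p) / 2 ^ Suc (snd p) = spike_center (fst p) / 2 ^ Suc (snd q)"
    unfolding fst by (subst (asm) ennreal_inj) (auto simp: less_imp_le)
  then have "(2 :: real) ^ Suc (snd p) = 2 ^ Suc (snd q)"
    using spike_center_pos[of "fst p"] by (metis divide_cancel_left less_irrefl)
  then have "snd p = snd q" by simp
  with fst show "p = q" by (simp add: prod_eq_iff)
qed

lemma gamma_sparse_nested_intervals: "gamma_sparse (1 / 2) (range nested_interval)"
  unfolding gamma_sparse_def
proof (intro conjI exI)
  show "\<forall>A\<in>range nested_interval. bdd_interval A"
    unfolding nested_interval_def by (auto intro!: bdd_interval_greaterThanLessThan)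
  \<comment> \<open>The witness must be a function of the interval itself, so the index pair is
    recovered by \<open>the_inv\<close>.\<close>
  let ?E = "\<lambda>A. shell (the_inv nested_interval A)"
  have E: "?E (nested_interval p) = shell p" for p by (simp add: the_inv_f_f[OF inj_nested_interval])
  show "\<forall>A\<in>range nested_interval. ?E A \<in> sets lebesgue \<and> ?E A \<subseteq> A \<and>
      ennreal (1 / 2) * emeasure lebesgue A \<le> emeasure lebesgue (?E A)"
  proof clarify
    fix p :: "nat \<times> nat"
    have "ennreal (1 / 2) * emeasure lebesgue (nested_interval p) = emeasure lebesgue (shell p)"
      unfolding emeasure_nested_interval emeasure_shell by (subst ennreal_mult[symmetric]) (auto simp: less_imp_le)
    then show "?E (nested_interval p) \<in> sets lebesgue \<and> ?E (nested_interval p) \<subseteq> nested_interval p \<and>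
      ennreal (1 / 2) * emeasure lebesgue (nested_interval p) \<le> emeasure lebesgue (?E (nested_interval p))"
      using shell_subset[of p] unfolding E by (auto simp: shell_def)
  qed
  show "disjoint_family_on ?E (range nested_interval)"
    using disjoint_shells unfolding disjoint_family_on_def by (auto simp: E inj_eq[OF inj_nested_interval])
qed

text \<open>On (-1, 0) there are no spikes, and this is the reciprocal of the weight there. Hence
  f^2 w = f, and its squared norm is its plain integral 1/al.\<close>

definition extremizer :: "real \<Rightarrow> real \<Rightarrow> real" where
  "extremizer al x = \<bar>x\<bar> powr (al - 1) * indicator {-1<..<0} x"

lemma extremizer_measurable [measurable]: "extremizer al \<in> borel_measurable borel"
  unfolding extremizer_def by measurable

lemma extremizer_norm:
  assumes al: "0 < al"
  shows "(\<integral>\<^sup>+x. (ennreal \<bar>extremizer al x\<bar>)\<^sup>2 * ennreal (spiked_weight al x) \<partial>lebesgue) = ennreal (1 / al)"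
proof -
  have "(ennreal \<bar>extremizer al x\<bar>)\<^sup>2 * ennreal (spiked_weight al x)
     = ennreal (\<bar>x - 0\<bar> powr (al - 1)) * indicator {0 - 1<..<0} x" for x
  proof (cases "x \<in> {-1<..<0}")
    case True
    have "x \<notin> spike_region j" for j
      using True spike_center_pos[of j] by (auto simp: spike_region_def)
    then have w: "spiked_weight al x = \<bar>x\<bar> powr (1 - al)"
      using True by (simp add: spiked_weight_def spike_outside)
    have "(\<bar>x\<bar> powr (al - 1))\<^sup>2 * \<bar>x\<bar> powr (1 - al) = \<bar>x\<bar> powr (al - 1)"
      using True by (simp add: power2_eq_square flip: powr_add)
    then show ?thesis
      using True unfolding w by (simp add: extremizer_def ennreal_power flip: ennreal_mult)
  qed (simp add: extremizer_def)
  then show ?thesis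
    using nn_integral_powr_left[OF al, of 1 0] by simp
qed

text \<open>The interval (-r, 2 r) contains \<open>nested_interval (j, k)\<close> for every k and
  reaches the support of the extremizer. The bound does not depend on k: all nested intervals at r
  contribute equally, and the sum grows linearly in the depth.\<close>

lemma max_avg_extremizer_ge:
  assumes al: "0 < al"
  shows "ennreal (spike_center j powr (al - 1) / (3 * al)) \<le> max_avg (nested_interval (j, k)) (extremizer al)"
proof -
  define r where "r = spike_center j"
  have r: "0 < r" "r \<le> 1" by (auto simp: r_def spike_center_def intro: power_le_one)
  let ?I = "{- r<..<2 * r}"
  have sub: "nested_interval (j, k) \<subseteq> ?I"
    using nested_interval_subset_spike_region[of "(j, k)"] spike_region_subset[of _ j] r by (fastforce simp: r_def)
  have "ennreal (r powr al / al) = (\<integral>\<^sup>+x\<in>{0 - r<..<0}. ennreal (\<bar>x - 0\<bar> powr (al - 1)) \<partial>lebesgue)"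
    by (rule nn_integral_powr_left[OF al r(1), symmetric])
  also have "\<dots> \<le> (\<integral>\<^sup>+x\<in>?I. ennreal \<bar>extremizer al x\<bar> \<partial>lebesgue)"
    using r by (intro nn_integral_mono) (auto simp: extremizer_def indicator_def)
  finally have "ennreal (r powr al / al) / ennreal (3 * r) \<le> (\<integral>\<^sup>+x\<in>?I. ennreal \<bar>extremizer al x\<bar> \<partial>lebesgue) / ennreal (3 * r)"
    by (rule divide_right_mono_ennreal)
  also have "\<dots> = interval_avg (extremizer al) ?I"
    using r by (simp add: interval_avg_def)
  also have "\<dots> \<le> max_avg (nested_interval (j, k)) (extremizer al)"
    unfolding max_avg_def using sub r by (intro SUP_upper) (auto intro: bdd_interval_greaterThanLessThan)
  also have "ennreal (r powr al / al) / ennreal (3 * r) = ennreal (r powr (al - 1) / (3 * al))"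
    using r al by (simp add: divide_ennreal powr_diff)
  finally show ?thesis by (simp add: r_def)
qed

lemma strong_sparse_op_extremizer_ge:
  assumes al: "0 < al" and x: "x \<in> shell (j, k)"
  shows "ennreal (real (Suc k) * (spike_center j powr (al - 1) / (3 * al))) \<le> strong_sparse_op (range nested_interval) (extremizer al) x"
proof -
  let ?c = "spike_center j powr (al - 1) / (3 * al)"
  let ?F = "(\<lambda>i. nested_interval (j, i)) ` {..k}"
  have inj: "inj_on (\<lambda>i. nested_interval (j, i)) {..k}"
    using inj_nested_interval by (auto simp: inj_on_def inj_def)
  have "ennreal (real (Suc k) * ?c) = (\<Sum>i\<le>k. ennreal ?c)"
    using al by (subst ennreal_mult) (auto simp: ennreal_of_nat_eq_real_of_nat simp del: of_nat_Suc)
  also have "\<dots> \<le> (\<Sum>i\<le>k. max_avg (nested_interval (j, i)) (extremizer al) * indicator (nested_interval (j, i)) x)"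
  proof (rule sum_mono)
    fix i assume "i \<in> {..k}"
    then have "x \<in> nested_interval (j, i)" using x shell_subset_nested_interval[of i k j] by auto
    then show "ennreal ?c \<le> max_avg (nested_interval (j, i)) (extremizer al) * indicator (nested_interval (j, i)) x"
      using max_avg_extremizer_ge[OF al] by simp
  qed
  also have "\<dots> = (\<Sum>A\<in>?F. max_avg A (extremizer al) * indicator A x)"
    by (simp add: sum.reindex[OF inj])
  also have "\<dots> \<le> strong_sparse_op (range nested_interval) (extremizer al) x"
    unfolding strong_sparse_op_def
    by (subst nonneg_infsum_complete) (auto intro!: SUP_upper)
  finally show ?thesis .
qed

text \<open>With al = 1/N and h the length of the nested interval, the powers of r cancel, since
  (r^(al - 1))^2 r^(2 - 2 al) = 1. What remains is (k + 1)^2 / (9 al) times h^al / h, with k + 1 >=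
  N. The restrictions on j and k keep h^al bounded below, giving N^3 / (9 * 16 h).\<close>

lemma integrand_ge_on_shell:
  assumes N: "1 \<le> N" and j: "j < N" and k: "N \<le> Suc k" "Suc k \<le> 2 * N" and x: "x \<in> shell (j, k)"
  shows "ennreal (real N ^ 3 / 144 * (2 ^ Suc k / spike_center j))
    \<le> (strong_sparse_op (range nested_interval) (extremizer (1 / real N)) x)\<^sup>2 * ennreal (spiked_weight (1 / real N) x)"
proof -
  define al where "al = 1 / real N"
  have al: "0 < al" "al \<le> 1" using N by (auto simp: al_def)
  define r where "r = spike_center j"
  have r: "0 < r" by (simp add: r_def)
  define h where "h = r / 2 ^ Suc k"
  have h: "0 < h" using r by (simp add: h_def)
  let ?T = "real (Suc k) * (r powr (al - 1) / (3 * al))"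
  have xr: "r < x" "x < r + h"
    using x shell_subset[of "(j, k)"] by (auto simp: nested_interval_def r_def h_def simp del: power_Suc)
  have "spike al j x \<le> spiked_weight al x" by (rule spiked_weight_ge_spike[OF al(1)])
  moreover have "spike al j x = al * r powr (2 - 2 * al) * \<bar>x - r\<bar> powr (al - 1)"
    using x shell_subset[of "(j, k)"] nested_interval_subset_spike_region[of "(j, k)"] by (auto simp: spike_def r_def)
  moreover have "h powr (al - 1) \<le> \<bar>x - r\<bar> powr (al - 1)"
    using xr al by (intro powr_mono2') auto
  then have "al * r powr (2 - 2 * al) * h powr (al - 1) \<le> al * r powr (2 - 2 * al) * \<bar>x - r\<bar> powr (al - 1)"
    using al by (intro mult_left_mono) auto
  ultimately have w: "al * r powr (2 - 2 * al) * h powr (al - 1) \<le> spiked_weight al x" by simp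
  \<comment> \<open>h is 2^(-n) with n = 2 j + k + 1 <= 4 N, so h^al >= 2^(-4).\<close>
  have hal: "1 / 16 \<le> h powr al"
  proof -
    define n where "n = 2 * j + Suc k"
    have "h = 1 / (2 ^ (2 * j) * 2 ^ Suc k)"
      by (simp add: h_def r_def spike_center_def power_divide power_mult)
    also have "\<dots> = 1 / 2 ^ n" by (simp only: n_def power_add)
    also have "\<dots> = 2 powr (- real n)"
      by (simp add: powr_minus powr_realpow inverse_eq_divide)
    finally have "h powr al = 2 powr (- (real n * al))" by (simp add: powr_powr)
    moreover have "real n * al \<le> 4"
    proof -
      have "real n \<le> 4 * real N" using j k by (simp add: n_def)
      then show ?thesis using N by (simp add: al_def field_simps)
    qed
    then have "2 powr (- 4) \<le> (2 :: real) powr (- (real n * al))"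
      by (intro powr_mono) auto
    moreover have "(2 :: real) powr (- 4) = 1 / 16" by (simp add: powr_minus)
    ultimately show ?thesis by simp
  qed
  have "real N ^ 3 / 144 * (1 / h) \<le> ?T\<^sup>2 * (al * r powr (2 - 2 * al) * h powr (al - 1))"
  proof -
    have "(r powr (al - 1))\<^sup>2 * r powr (2 - 2 * al) = 1"
      using r by (simp add: power2_eq_square flip: powr_add)
    moreover have "(n * (X / (3 * al)))\<^sup>2 * (al * Y * Z) = n\<^sup>2 / (9 * al) * (X\<^sup>2 * Y * Z)" for n X Y Z :: real
      using al by (simp add: field_simps power2_eq_square)
    moreover have "h powr (al - 1) = h powr al / h" using h by (simp add: powr_diff)
    ultimately have "?T\<^sup>2 * (al * r powr (2 - 2 * al) * h powr (al - 1)) =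
       (real (Suc k))\<^sup>2 / (9 * al) * (h powr al / h)"
      by (simp only: mult_1)
    also have "\<dots> \<ge> (real N)\<^sup>2 / (9 * al) * ((1 / 16) / h)"
      using al h hal k by (intro mult_mono divide_right_mono power_mono) auto
    also have "(real N)\<^sup>2 / (9 * al) * ((1 / 16) / h) = real N ^ 3 / 144 * (1 / h)"
      using N by (simp add: al_def power2_eq_square power3_eq_cube)
    finally show ?thesis .
  qed
  also have "\<dots> \<le> ?T\<^sup>2 * spiked_weight al x" using w by (rule mult_left_mono) simp
  finally have "ennreal (real N ^ 3 / 144 * (1 / h)) \<le> ennreal (?T\<^sup>2 * spiked_weight al x)" by (rule ennreal_leI)
  also have "\<dots> = (ennreal ?T)\<^sup>2 * ennreal (spiked_weight al x)"
    using al by (subst ennreal_mult') (auto simp: ennreal_power)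
  also have "\<dots> \<le> (strong_sparse_op (range nested_interval) (extremizer al) x)\<^sup>2 * ennreal (spiked_weight al x)"
    using strong_sparse_op_extremizer_ge[OF al(1) x] by (intro mult_right_mono power_mono) (auto simp: r_def)
  finally show ?thesis by (simp add: al_def h_def r_def)
qed

text \<open>A shell has length h / 2, so the lower bound of order 1/h gives each of the N^2 shells
  the same contribution N^3 / 288.\<close>

lemma strong_sparse_op_extremizer_norm_ge:
  assumes N: "1 \<le> N"
  shows "ennreal (real N ^ 5 / 288) \<le>
    (\<integral>\<^sup>+x. (strong_sparse_op (range nested_interval) (extremizer (1 / real N)) x)\<^sup>2 * ennreal (spiked_weight (1 / real N) x) \<partial>lebesgue)"
proof -
  let ?F = "{..<N} \<times> {N..<2 * N}"
  let ?d = "\<lambda>p. ennreal (real N ^ 3 / 144 * (2 ^ Suc (snd p) / spike_center (fst p)))"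
  let ?g = "\<lambda>x. (strong_sparse_op (range nested_interval) (extremizer (1 / real N)) x)\<^sup>2 * ennreal (spiked_weight (1 / real N) x)"
  have meas: "shell p \<in> sets lebesgue" for p by (simp add: shell_def)
  have mass: "?d p * emeasure lebesgue (shell p) = ennreal (real N ^ 3 / 288)" for p
    unfolding emeasure_shell using spike_center_pos[of "fst p"]
    by (subst ennreal_mult[symmetric]) (auto simp: less_imp_le)
  have "ennreal (real N ^ 5 / 288) = (\<Sum>p\<in>?F. ennreal (real N ^ 3 / 288))"
    by (simp add: ennreal_of_nat_eq_real_of_nat power_numeral_reduce mult_ac flip: ennreal_mult)
  also have "\<dots> = (\<Sum>p\<in>?F. \<integral>\<^sup>+x. ?d p * indicator (shell p) x \<partial>lebesgue)"
    by (simp only: nn_integral_cmult_indicator[OF meas] mass)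
  also have "\<dots> = (\<integral>\<^sup>+x. (\<Sum>p\<in>?F. ?d p * indicator (shell p) x) \<partial>lebesgue)"
    by (intro nn_integral_sum[symmetric] borel_measurable_times_ennreal borel_measurable_indicator) (auto simp: shell_def)
  also have "\<dots> \<le> (\<integral>\<^sup>+x. ?g x \<partial>lebesgue)"
  proof (rule nn_integral_mono)
    fix x
    show "(\<Sum>p\<in>?F. ?d p * indicator (shell p) x) \<le> ?g x"
    proof (cases "\<exists>p\<in>?F. x \<in> shell p")
      case True
      then obtain p where p: "p \<in> ?F" "x \<in> shell p" by blast
      have "(\<Sum>q\<in>?F. ?d q * indicator (shell q) x) = (\<Sum>q\<in>{p}. ?d q * indicator (shell q) x)"
      proof (rule sum.mono_neutral_right)
        show "\<forall>q\<in>?F - {p}. ?d q * indicator (shell q) x = 0"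
        proof
          fix q assume "q \<in> ?F - {p}"
          then have "shell p \<inter> shell q = {}"
            using disjoint_family_onD[OF disjoint_shells, of p q] by auto
          then have "x \<notin> shell q" using p(2) by blast
          then show "?d q * indicator (shell q) x = 0" by simp
        qed
      qed (use p in auto)
      also have "\<dots> = ?d p" using p by simp
      also have "\<dots> \<le> ?g x"
        using integrand_ge_on_shell[OF N, of "fst p" "snd p" x] p by auto
      finally show ?thesis .
    next
      case False
      then have "(\<Sum>p\<in>?F. ?d p * indicator (shell p) x) = 0" by (intro sum.neutral) auto
      then show ?thesis by simp
    qed
  qed
  finally show ?thesis .
qed

text \<open>The squared norm of the extremizer is N, so the quotient is at least N^2 / sqrt 288, and
  17^2 = 289 > 288.\<close>

lemma strong_sparse_lower_bound:
  assumes N: "1 \<le> N"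
  shows "ennreal ((real N)\<^sup>2 / 17) \<le> L2_op_norm (spiked_weight (1 / real N)) (strong_sparse_op (range nested_interval))"
proof -
  define al where "al = 1 / real N"
  have al: "0 < al" using N by (simp add: al_def)
  let ?w = "spiked_weight al" and ?f = "extremizer al" and ?T = "strong_sparse_op (range nested_interval)"
  have norm: "L2_norm ?w (\<lambda>x. ennreal \<bar>?f x\<bar>) = ennreal (sqrt (real N))"
    unfolding L2_norm_def extremizer_norm[OF al] by (simp add: ennreal_sqrt_def al_def)
  have "?f \<in> borel_measurable lebesgue" by (intro measurable_completion) simp
  then have L2: "?f \<in> L2_space ?w" by (simp add: L2_space_def norm)
  have nonzero: "\<not> (AE x in lebesgue. ?f x = 0)"
  proof
    assume "AE x in lebesgue. ?f x = 0"
    then obtain x where "-1 < x" "x < 0" "?f x = 0"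
      using AE_lebesgue_ex_interval[of "\<lambda>x. ?f x = 0" "-1" 0] by auto
    then show False by (simp add: extremizer_def)
  qed
  have "(ennreal ((real N)\<^sup>2 / 17) * ennreal (sqrt (real N)))\<^sup>2 = ennreal (((real N)\<^sup>2 / 17 * sqrt (real N))\<^sup>2)"
    by (simp add: ennreal_power flip: ennreal_mult)
  also have "((real N)\<^sup>2 / 17 * sqrt (real N))\<^sup>2 = real N ^ 5 / 289"
    by (simp add: power_mult_distrib power_divide power_numeral_reduce)
  also have "ennreal (real N ^ 5 / 289) \<le> ennreal (real N ^ 5 / 288)"
    by (intro ennreal_leI divide_left_mono) auto
  also have "\<dots> \<le> (L2_norm ?w (?T ?f))\<^sup>2"
    using strong_sparse_op_extremizer_norm_ge[OF N] by (simp add: L2_norm_def al_def)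
  finally have "ennreal ((real N)\<^sup>2 / 17) * ennreal (sqrt (real N)) \<le> L2_norm ?w (?T ?f)"
    by (rule ennreal_power2_le_imp_le)
  then have "ennreal ((real N)\<^sup>2 / 17) * ennreal (sqrt (real N)) / ennreal (sqrt (real N))
      \<le> L2_norm ?w (?T ?f) / L2_norm ?w (\<lambda>x. ennreal \<bar>?f x\<bar>)"
    unfolding norm by (rule divide_right_mono_ennreal)
  also have "\<dots> \<le> L2_op_norm ?w ?T"
    unfolding L2_op_norm_def using L2 nonzero by (intro SUP_upper) auto
  also have "ennreal ((real N)\<^sup>2 / 17) * ennreal (sqrt (real N)) / ennreal (sqrt (real N)) = ennreal ((real N)\<^sup>2 / 17)"
    using N by (intro ennreal_mult_divide_cancel_right) simp
  finally show ?thesis by (simp add: al_def)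
qed

text \<open>The lower estimate compares the two operator bounds for this family, which is sparse
  with constant 1/2: N^2 / 17 <= 512 a^2. Here 512 = 256 / (1/2), and 17 * 512 = 8704 <= 8836 =
  94^2.\<close>

lemma A2_const_spiked_weight_bounds:
  assumes N: "1 \<le> N"
  obtains a where "A2_const (spiked_weight (1 / real N)) = ennreal a" "real N / 94 \<le> a" "a \<le> 52020 * real N"
proof -
  let ?w = "spiked_weight (1 / real N)"
  have al: "0 < 1 / real N" "1 / real N \<le> 1" using N by auto
  have up: "A2_const ?w \<le> ennreal (52020 * real N)"
    using A2_const_spiked_weight_le[OF al] by simp
  then obtain a where a: "A2_const ?w = ennreal a" "0 \<le> a"
    by (metis ennreal_cases ennreal_neq_top top_unique)
  have "ennreal ((real N)\<^sup>2 / 17) \<le> L2_op_norm ?w (strong_sparse_op (range nested_interval))"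
    by (rule strong_sparse_lower_bound[OF N])
  also have "\<dots> \<le> ennreal (256 / (1 / 2)) * (A2_const ?w)\<^sup>2"
    by (rule strong_sparse_upper_bound[OF _ gamma_sparse_nested_intervals A2_weight_spiked_weight[OF al]]) simp
  also have "\<dots> = ennreal (512 * a\<^sup>2)" using a by (simp add: ennreal_power flip: ennreal_mult ennreal_numeral)
  finally have "(real N)\<^sup>2 / 17 \<le> 512 * a\<^sup>2" by (simp add: ennreal_le_iff)
  moreover have "8704 * a\<^sup>2 \<le> 8836 * a\<^sup>2" by (intro mult_right_mono) auto
  moreover have "(94 * a)\<^sup>2 = 8836 * a\<^sup>2" by (simp add: power_mult_distrib)
  ultimately have "(real N)\<^sup>2 \<le> (94 * a)\<^sup>2" by linarith
  then have "real N \<le> 94 * a" by (rule power2_le_imp_le) (use a(2) in simp)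
  then show ?thesis using that a up by (simp add: ennreal_le_iff)
qed

section \<open>Asymptotics along the parameters 1/(n + 1)\<close>

definition weight_param :: "nat \<Rightarrow> real" where
  "weight_param n = 1 / real (Suc n)"

lemma weight_param_bounds: "0 < weight_param n" "weight_param n \<le> 1"
  by (simp_all add: weight_param_def)

lemma weight_param_tendsto: "weight_param \<longlonglongrightarrow> 0"
  unfolding weight_param_def by (rule LIMSEQ_Suc[OF lim_1_over_n])

lemma A2_const_weight_param:
  "\<exists>a. \<forall>n. A2_const (spiked_weight (weight_param n)) = ennreal (a n) \<and>
     real (Suc n) / 94 \<le> a n \<and> a n \<le> 52020 * real (Suc n)"
proof -
  have "\<exists>a. A2_const (spiked_weight (weight_param n)) = ennreal a \<and> real (Suc n) / 94 \<le> a \<and> a \<le> 52020 * real (Suc n)" for n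
    using A2_const_spiked_weight_bounds[of "Suc n"] unfolding weight_param_def
    by (metis One_nat_def Suc_le_mono zero_le)
  then show ?thesis by metis
qed

lemma at_top_if_ge_Suc:
  assumes "\<And>n. real (Suc n) / 94 \<le> a n"
  shows "filterlim a at_top sequentially"
proof (rule filterlim_at_top_mono)
  show "filterlim (\<lambda>n. real (Suc n) * (1 / 94)) at_top sequentially"
    by (intro filterlim_at_top_mult_tendsto_pos[of _ "1 / 94"] tendsto_const
          filterlim_compose[OF filterlim_real_sequentially filterlim_Suc]) auto
qed (use assms in auto)

lemma A2_const_tendsto_infinity: "(\<lambda>n. A2_const (spiked_weight (weight_param n))) \<longlonglongrightarrow> \<infinity>"
proof -
  obtain a where a: "\<And>n. A2_const (spiked_weight (weight_param n)) = ennreal (a n)"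
    "\<And>n. real (Suc n) / 94 \<le> a n" "\<And>n. a n \<le> 52020 * real (Suc n)"
    using A2_const_weight_param by blast
  show ?thesis
    unfolding a(1) infinity_ennreal_def tendsto_top_iff_ennreal
  proof (intro allI impI)
    fix l :: real assume "0 \<le> l"
    have "\<forall>\<^sub>F n in sequentially. l < a n"
      using at_top_if_ge_Suc[OF a(2)] by (simp add: filterlim_at_top_dense)
    then show "\<forall>\<^sub>F n in sequentially. ennreal l < ennreal (a n)"
      by eventually_elim (use \<open>0 \<le> l\<close> in \<open>simp add: ennreal_less_iff\<close>)
  qed
qed

text \<open>Both estimates of the A2 constant a(n) enter. The lower one sends a(n) to infinity, so
  that \<phi>(a(n)) is small against its square; the upper one compares that square with (n + 1)^2,
  the order of the operator norm.\<close>

lemma quotient_tendsto_infinity: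
  assumes nonneg: "\<And>x. 0 \<le> x \<Longrightarrow> 0 \<le> \<phi> x" and \<phi>: "((\<lambda>x. \<phi> x / x\<^sup>2) \<longlongrightarrow> 0) at_top"
  shows "(\<lambda>n. ext_quotient (L2_op_norm (spiked_weight (weight_param n)) (strong_sparse_op (range nested_interval)))
     (ennreal (\<phi> (enn2real (A2_const (spiked_weight (weight_param n))))))) \<longlonglongrightarrow> \<infinity>"
proof -
  obtain a where a: "\<And>n. A2_const (spiked_weight (weight_param n)) = ennreal (a n)"
    "\<And>n. real (Suc n) / 94 \<le> a n" "\<And>n. a n \<le> 52020 * real (Suc n)"
    using A2_const_weight_param by blast
  have a_pos: "0 < a n" for n using a(2)[of n] by (rule less_le_trans[rotated]) simp
  have op: "ennreal ((real (Suc n))\<^sup>2 / 17) \<le> L2_op_norm (spiked_weight (weight_param n)) (strong_sparse_op (range nested_interval))" for n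
    using strong_sparse_lower_bound[of "Suc n"] by (simp add: weight_param_def)
  show ?thesis
    unfolding infinity_ennreal_def tendsto_top_iff_ennreal
  proof (intro allI impI)
    fix l :: real assume l: "0 \<le> l"
    \<comment> \<open>Chosen so that \<epsilon> (52020 N)^2 = N^2 / (17 (l + 1)), which is the lower
      bound of the operator norm divided by l + 1; the added 1 makes the final inequality
      strict.\<close>
    define \<epsilon> where "\<epsilon> = 1 / (17 * 52020\<^sup>2 * (l + 1))"
    have \<epsilon>: "0 < \<epsilon>" using l by (simp add: \<epsilon>_def)
    have "\<forall>\<^sub>F x in at_top. \<phi> x / x\<^sup>2 < \<epsilon>" using order_tendstoD(2)[OF \<phi> \<epsilon>] .
    then have "\<forall>\<^sub>F n in sequentially. \<phi> (a n) / (a n)\<^sup>2 < \<epsilon>"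
      using at_top_if_ge_Suc[OF a(2)] unfolding filterlim_iff by blast
    then show "\<forall>\<^sub>F n in sequentially. ennreal l < ext_quotient (L2_op_norm (spiked_weight (weight_param n)) (strong_sparse_op (range nested_interval)))
       (ennreal (\<phi> (enn2real (A2_const (spiked_weight (weight_param n))))))"
    proof eventually_elim
      case (elim n)
      have arg: "enn2real (A2_const (spiked_weight (weight_param n))) = a n"
        using a_pos[of n] by (simp add: a(1) less_imp_le)
      let ?N = "real (Suc n)" and ?op = "L2_op_norm (spiked_weight (weight_param n)) (strong_sparse_op (range nested_interval))"
      show ?case
      proof (cases "\<phi> (a n) = 0")
        case True
        then show ?thesis by (simp add: arg ext_quotient_def)
      next
        case False
        then have pos: "0 < \<phi> (a n)" using nonneg[of "a n"] a_pos[of n] by simp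
        have "\<phi> (a n) \<le> \<epsilon> * (a n)\<^sup>2" using elim a_pos[of n] by (simp add: divide_less_eq)
        also have "\<dots> \<le> \<epsilon> * (52020 * ?N)\<^sup>2"
          using \<epsilon> a(3)[of n] a_pos[of n] by (intro mult_left_mono power_mono) auto
        also have "\<dots> = ?N\<^sup>2 / 17 / (l + 1)" using l by (simp add: \<epsilon>_def power_mult_distrib frac_eq_eq algebra_simps del: of_nat_Suc)
        finally have "(l + 1) * \<phi> (a n) \<le> ?N\<^sup>2 / 17" using l by (simp add: pos_le_divide_eq algebra_simps del: of_nat_Suc)
        then have "l + 1 \<le> ?N\<^sup>2 / 17 / \<phi> (a n)" using pos by (simp add: le_divide_eq)
        then have "ennreal l < ennreal (?N\<^sup>2 / 17 / \<phi> (a n))" using l by (intro ennreal_lessI) auto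
        also have "\<dots> = ennreal (?N\<^sup>2 / 17) / ennreal (\<phi> (a n))"
          using pos by (intro divide_ennreal[symmetric]) auto
        also have "\<dots> \<le> ?op / ennreal (\<phi> (a n))" by (rule divide_right_mono_ennreal[OF op])
        also have "\<dots> = ext_quotient ?op (ennreal (\<phi> (a n)))" using pos by (simp add: ext_quotient_def)
        finally show ?thesis by (simp only: arg)
      qed
    qed
  qed
qed

theorem theorem2:
  shows "(\<forall>\<gamma>::real. 0 < \<gamma> \<and> \<gamma> < 1 \<longrightarrow>
           (\<exists>C::real. 0 \<le> C \<and>
             (\<forall>S w. gamma_sparse \<gamma> S \<and> A2_weight w \<longrightarrow>
                L2_op_norm w (strong_sparse_op S) \<le> ennreal C * (A2_const w)\<^sup>2)))
       \<and>
         (\<exists>(S :: real set set) (\<alpha> :: nat \<Rightarrow> real) (w :: real \<Rightarrow> real \<Rightarrow> real).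
            sparse_family S \<and>
            (\<forall>n. 0 < \<alpha> n) \<and> \<alpha> \<longlonglongrightarrow> 0 \<and>
            (\<forall>n. A2_weight (w (\<alpha> n))) \<and>
            (\<lambda>n. A2_const (w (\<alpha> n))) \<longlonglongrightarrow> \<infinity> \<and>
            (\<forall>\<phi> :: real \<Rightarrow> real.
               (\<forall>x\<ge>0. 0 \<le> \<phi> x) \<and> ((\<lambda>x. \<phi> x / x\<^sup>2) \<longlongrightarrow> 0) at_top \<longrightarrow>
               (\<lambda>n. ext_quotient (L2_op_norm (w (\<alpha> n)) (strong_sparse_op S))
                       (ennreal (\<phi> (enn2real (A2_const (w (\<alpha> n))))))) \<longlonglongrightarrow> \<infinity>))"
proof (intro conjI allI impI)
  fix \<gamma> :: real
  assume \<gamma>: "0 < \<gamma> \<and> \<gamma> < 1"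
  then show "\<exists>C::real. 0 \<le> C \<and>
      (\<forall>S w. gamma_sparse \<gamma> S \<and> A2_weight w \<longrightarrow>
         L2_op_norm w (strong_sparse_op S) \<le> ennreal C * (A2_const w)\<^sup>2)"
    by (intro exI[of _ "256 / \<gamma>"]) (simp add: strong_sparse_upper_bound)
next
  have "sparse_family (range nested_interval)"
    unfolding sparse_family_def using gamma_sparse_nested_intervals by (intro exI[of _ "1 / 2"]) simp
  then show "\<exists>(S :: real set set) (\<alpha> :: nat \<Rightarrow> real) (w :: real \<Rightarrow> real \<Rightarrow> real).
            sparse_family S \<and>
            (\<forall>n. 0 < \<alpha> n) \<and> \<alpha> \<longlonglongrightarrow> 0 \<and>
            (\<forall>n. A2_weight (w (\<alpha> n))) \<and>
            (\<lambda>n. A2_const (w (\<alpha> n))) \<longlonglongrightarrow> \<infinity> \<and>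
            (\<forall>\<phi> :: real \<Rightarrow> real.
               (\<forall>x\<ge>0. 0 \<le> \<phi> x) \<and> ((\<lambda>x. \<phi> x / x\<^sup>2) \<longlongrightarrow> 0) at_top \<longrightarrow>
               (\<lambda>n. ext_quotient (L2_op_norm (w (\<alpha> n)) (strong_sparse_op S))
                       (ennreal (\<phi> (enn2real (A2_const (w (\<alpha> n))))))) \<longlonglongrightarrow> \<infinity>)"
    using weight_param_bounds weight_param_tendsto A2_weight_spiked_weight A2_const_tendsto_infinity
      quotient_tendsto_infinity
    by (intro exI[of _ "range nested_interval"] exI[of _ weight_param] exI[of _ spiked_weight]) simp
qed

end
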